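(* For any prime $p$, the group $$\Lambda_p=\langle a,s,t \mid a^p,\ [s,t],\ [a^t,a],\ a^s=a^ta\rangle$$ embeds as a cocompact lattice (i.e. is isomorphic to a discrete cocompact subgroup) in the locally compact group $\mathrm{SOL}_5(\mathbf{F}_p(\!(u)\!))$.
   Context: Here $a^t$ denotes the conjugate of $a$ by $t$ and $[x,y]$ the commutator. $\mathbf{F}_p(\!(u)\!)$ is the local field of Laurent series over the finite field $\mathbf{F}_p$. For a local field $\mathbf{K}$ and $d\ge 1$, $\mathrm{SOL}_{2d-1}(\mathbf{K})$ denotes the semidirect product $\mathbf{K}^d\rtimes D$, where $D$ is the group of invertible $d\times d$ diagonal matrices over $\mathbf{K}$ with determinant of norm one, acting on $\mathbf{K}^d$ in the natural way. Thus $\mathrm{SOL}_5(\mathbf{K})$ corresponds to $d=3$. *)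

theory Defs
  imports
    "HOL-Analysis.Analysis"
    "HOL-Computational_Algebra.Formal_Laurent_Series"
    "HOL-Algebra.Left_Coset"
    "Berlekamp_Zassenhaus.Finite_Field"
begin

no_notation fps_nth (infixl "$" 75)

section \<open>Group presentations\<close>

text \<open>A word is a list of letters \<open>(x, e)\<close>; \<open>(x, True)\<close> stands for the generator \<open>x\<close> and
  \<open>(x, False)\<close> for its formal inverse.\<close>

type_synonym 'g word = "('g \<times> bool) list"

inductive free_eq :: "'g word \<Rightarrow> 'g word \<Rightarrow> bool" where
  free_eq_refl: "free_eq u u"
| free_eq_sym: "free_eq u v \<Longrightarrow> free_eq v u"
| free_eq_trans: "free_eq u v \<Longrightarrow> free_eq v w \<Longrightarrow> free_eq u w"
| free_eq_cancel: "free_eq (u @ [(x, e), (x, \<not> e)] @ v) (u @ v)"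

definition free_class :: "'g word \<Rightarrow> 'g word set" where
  "free_class u = {v. free_eq u v}"

definition free_group :: "'g word set monoid" where
  "free_group =
     \<lparr>carrier = range free_class,
      mult = (\<lambda>A B. \<Union>u\<in>A. \<Union>v\<in>B. free_class (u @ v)),
      one = free_class []\<rparr>"

definition free_gen :: "'g \<Rightarrow> 'g word set" where
  "free_gen x = free_class [(x, True)]"

definition normal_closure :: "('a, 'b) monoid_scheme \<Rightarrow> 'a set \<Rightarrow> 'a set" where
  "normal_closure G R = \<Inter>{N. N \<lhd> G \<and> R \<subseteq> N}"

definition presented_group :: "'g word set set \<Rightarrow> 'g word set set monoid" where
  "presented_group R = free_group Mod (normal_closure free_group R)"

lemma free_class_eq_iff: "free_class u = free_class v \<longleftrightarrow> free_eq u v"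
  unfolding free_class_def
  by (auto intro: free_eq_refl free_eq_sym free_eq_trans)

lemma free_eq_append: "free_eq u u' \<Longrightarrow> free_eq (w @ u @ z) (w @ u' @ z)"
proof (induction rule: free_eq.induct)
  case (free_eq_cancel u x e v)
  show ?case using free_eq.free_eq_cancel[of "w @ u" x e "v @ z"] by simp
qed (rule free_eq_refl, erule free_eq_sym, erule free_eq_trans, assumption)

lemma free_eq_append2: "free_eq u u' \<Longrightarrow> free_eq v v' \<Longrightarrow> free_eq (u @ v) (u' @ v')"
  using free_eq_trans[of "u @ v" "u' @ v" "u' @ v'"]
    free_eq_append[of u u' "[]" v] free_eq_append[of v v' u' "[]"]
  by simp

lemma free_group_carrier: "carrier free_group = range free_class"
  and free_group_one: "\<one>\<^bsub>free_group\<^esub> = free_class []"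
  by (simp_all add: free_group_def)

lemma free_group_mult:
  "free_class u \<otimes>\<^bsub>free_group\<^esub> free_class v = free_class (u @ v)"
proof -
  have eq: "free_class (u' @ v') = free_class (u @ v)"
    if "u' \<in> free_class u" "v' \<in> free_class v" for u' v'
  proof -
    have "free_eq (u @ v) (u' @ v')"
      using that by (intro free_eq_append2) (simp_all add: free_class_def)
    then show ?thesis by (simp add: free_class_eq_iff free_eq_sym)
  qed
  have mem: "u \<in> free_class u" "v \<in> free_class v"
    by (simp_all add: free_class_def free_eq_refl)
  have "(\<Union>u'\<in>free_class u. \<Union>v'\<in>free_class v. free_class (u' @ v'))
      = (\<Union>u'\<in>free_class u. \<Union>v'\<in>free_class v. free_class (u @ v))"
    by (intro SUP_cong refl eq)
  also have "\<dots> = free_class (u @ v)"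
    using mem by blast
  finally show ?thesis
    by (simp add: free_group_def)
qed

lemma free_eq_inverse:
  "free_eq (rev (map (\<lambda>(x, e). (x, \<not> e)) u) @ u) []"
proof (induction u)
  case (Cons l u)
  obtain x e where l: "l = (x, e)" by fastforce
  have "free_eq (rev (map (\<lambda>(x, e). (x, \<not> e)) (l # u)) @ l # u)
      (rev (map (\<lambda>(x, e). (x, \<not> e)) u) @ u)"
    using free_eq_cancel[of "rev (map (\<lambda>(x, e). (x, \<not> e)) u)" x "\<not> e" u] by (simp add: l)
  then show ?case using Cons.IH by (rule free_eq_trans)
qed (simp add: free_eq_refl)

lemma group_free_group: "group free_group"
proof (rule groupI)
  fix A :: "'a word set" assume "A \<in> carrier free_group"
  then obtain u where u: "A = free_class u" by (auto simp: free_group_carrier)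
  show "\<exists>B\<in>carrier free_group. B \<otimes>\<^bsub>free_group\<^esub> A = \<one>\<^bsub>free_group\<^esub>"
    by (rule bexI[of _ "free_class (rev (map (\<lambda>(x, e). (x, \<not> e)) u))"])
       (auto simp: u free_group_mult free_group_one free_group_carrier free_class_eq_iff
          free_eq_inverse)
qed (auto simp: free_group_carrier free_group_one free_group_mult)

lemma normal_normal_closure:
  assumes "group G" "R \<subseteq> carrier G"
  shows "normal_closure G R \<lhd> G"
proof -
  interpret group G by fact
  have "carrier G \<lhd> G"
    by (auto simp: normal_inv_iff subgroup_self)
  then have "subgroup (\<Inter>{N. N \<lhd> G \<and> R \<subseteq> N}) G"
    using assms(2) by (intro subgroups_Inter) (auto simp: normal_imp_subgroup)
  then show ?thesis
    unfolding normal_closure_def by (auto simp: normal_inv_iff)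
qed

lemma group_presented_group:
  assumes "R \<subseteq> carrier free_group"
  shows "group (presented_group R)"
  unfolding presented_group_def
  using normal.factorgroup_is_group normal_normal_closure group_free_group assms by blast

text \<open>The convention is \<open>x^g = g^-1 x g\<close>.\<close>

definition conjugate :: "('a, 'b) monoid_scheme \<Rightarrow> 'a \<Rightarrow> 'a \<Rightarrow> 'a" where
  "conjugate G x g = inv\<^bsub>G\<^esub> g \<otimes>\<^bsub>G\<^esub> x \<otimes>\<^bsub>G\<^esub> g"

definition commutator :: "('a, 'b) monoid_scheme \<Rightarrow> 'a \<Rightarrow> 'a \<Rightarrow> 'a" where
  "commutator G x y = inv\<^bsub>G\<^esub> x \<otimes>\<^bsub>G\<^esub> inv\<^bsub>G\<^esub> y \<otimes>\<^bsub>G\<^esub> x \<otimes>\<^bsub>G\<^esub> y"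

datatype gen = Gen_a | Gen_s | Gen_t

text \<open>A relation \<open>x = y\<close> is encoded by the relator \<open>x y^-1\<close>.\<close>

definition Lambda_relators :: "nat \<Rightarrow> gen word set set" where
  "Lambda_relators p =
     (let F = free_group; a = free_gen Gen_a; s = free_gen Gen_s; t = free_gen Gen_t in
      {a [^]\<^bsub>F\<^esub> p,
       commutator F s t,
       commutator F (conjugate F a t) a,
       conjugate F a s \<otimes>\<^bsub>F\<^esub> inv\<^bsub>F\<^esub> (conjugate F a t \<otimes>\<^bsub>F\<^esub> a)})"

definition Lambda :: "nat \<Rightarrow> gen word set set monoid" where
  "Lambda p = presented_group (Lambda_relators p)"

lemma Lambda_relators_carrier: "Lambda_relators p \<subseteq> carrier free_group"
proof -
  interpret group "free_group :: gen word set monoid" by (rule group_free_group)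
  have "free_gen x \<in> carrier free_group" for x :: gen
    by (simp add: free_gen_def free_group_carrier)
  then show ?thesis
    by (simp add: Lambda_relators_def Let_def conjugate_def commutator_def)
qed

lemma group_Lambda: "group (Lambda p)"
  unfolding Lambda_def by (rule group_presented_group[OF Lambda_relators_carrier])


section \<open>The groups SOL over a field of Laurent series\<close>

text \<open>The normalised absolute value of the local field of Laurent series over a finite field.  It
  induces the topology of the metric space instance for \<^typ>\<open>'k fls\<close>, whose distance uses the
  base 2 instead of the cardinality of the residue field.\<close>

definition fls_norm :: "'k::{finite,zero} fls \<Rightarrow> real" where
  "fls_norm f = (if f = 0 then 0 else real CARD('k) powi (- fls_subdegree f))"

definition SOL_diag :: "('k::{finite,field} fls ^ 'n ^ 'n) set" where
  "SOL_diag = {M. (\<forall>i j. i \<noteq> j \<longrightarrow> M $ i $ j = 0) \<and> invertible M \<and> fls_norm (det M) = 1}"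

text \<open>For an index type \<open>'n\<close> of cardinality \<open>d\<close> this is the group usually written with subscript
  \<open>2d - 1\<close>, so that \<open>d = 3\<close> gives \<open>SOL5\<close> below.\<close>

definition SOL :: "(('k::{finite,field} fls ^ 'n) \<times> ('k fls ^ 'n ^ 'n)) monoid" where
  "SOL = \<lparr>carrier = UNIV \<times> SOL_diag,
          mult = (\<lambda>(v, M) (w, N). (v + M *v w, M ** N)),
          one = (0, mat 1)\<rparr>"

text \<open>The subspace topology inherited from vectors and matrices is the group topology of the
  semidirect product, because inversion is continuous on the nonzero Laurent series.\<close>

definition SOL_topology :: "(('k::{finite,field} fls ^ 'n) \<times> ('k fls ^ 'n ^ 'n)) topology" where
  "SOL_topology = top_of_set (carrier SOL)"

abbreviation SOL5 :: "(('k::{finite,field} fls ^ 3) \<times> ('k fls ^ 3 ^ 3)) monoid" where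
  "SOL5 \<equiv> SOL"

abbreviation SOL5_topology :: "(('k::{finite,field} fls ^ 3) \<times> ('k fls ^ 3 ^ 3)) topology" where
  "SOL5_topology \<equiv> SOL_topology"

lemma fls_norm_mult:
  fixes f g :: "'k::{finite,field} fls"
  shows "fls_norm (f * g) = fls_norm f * fls_norm g"
  using power_int_add[of "real CARD('k)" "- fls_subdegree f" "- fls_subdegree g"]
  by (simp add: fls_norm_def)

lemma diag_mult_nth:
  fixes M N :: "'a::semiring_1 ^ 'n ^ 'n"
  assumes "\<And>i j. i \<noteq> j \<Longrightarrow> M $ i $ j = 0"
  shows "(M ** N) $ i $ j = M $ i $ i * N $ i $ j"
proof -
  have "(\<Sum>k\<in>UNIV. M $ i $ k * N $ k $ j) = (\<Sum>k\<in>{i}. M $ i $ k * N $ k $ j)"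
    using assms by (intro sum.mono_neutral_right) auto
  then show ?thesis by (simp add: matrix_matrix_mult_def)
qed

lemma SOL_diag_one: "mat 1 \<in> SOL_diag"
  using invertible_def[of "mat 1"] unfolding SOL_diag_def
  by (auto simp: fls_norm_def) (auto simp: mat_def)

lemma SOL_diag_mult:
  assumes "M \<in> SOL_diag" "N \<in> SOL_diag"
  shows "M ** N \<in> SOL_diag"
  using assms diag_mult_nth[of M N] unfolding SOL_diag_def
  by (auto simp: invertible_mult det_mul fls_norm_mult)

lemma SOL_diag_inverse:
  fixes M :: "'k::{finite,field} fls ^ 'n ^ 'n"
  assumes M: "M \<in> SOL_diag"
  obtains N where "N \<in> SOL_diag" "M ** N = mat 1" "N ** M = mat 1"
proof -
  obtain N where N: "M ** N = mat 1" "N ** M = mat 1"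
    using M unfolding SOL_diag_def invertible_def by blast
  have nth: "M $ i $ i * N $ i $ j = (if i = j then 1 else 0)" for i j
    using diag_mult_nth[of M N i j] M N(1) by (simp add: SOL_diag_def mat_def)
  have "N $ i $ j = 0" if "i \<noteq> j" for i j
    using nth[of i i] nth[of i j] that by auto
  moreover have "fls_norm (det M) * fls_norm (det N) = 1"
    using arg_cong[OF N(1), of det]
    by (simp add: det_mul fls_norm_mult[symmetric]) (simp add: fls_norm_def)
  moreover have "invertible N"
    using N unfolding invertible_def by blast
  ultimately have "N \<in> SOL_diag"
    using M by (simp add: SOL_diag_def)
  with N that show thesis by blast
qed

lemma group_SOL: "group (SOL :: (('k::{finite,field} fls ^ 'n) \<times> ('k fls ^ 'n ^ 'n)) monoid)"
  (is "group ?G")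
proof (rule groupI)
  fix x assume "x \<in> carrier ?G"
  then obtain v M where x: "x = (v, M)" "M \<in> SOL_diag" by (auto simp: SOL_def)
  obtain N where N: "N \<in> SOL_diag" "M ** N = mat 1" "N ** M = mat 1"
    using SOL_diag_inverse[OF x(2)] by blast
  show "\<exists>y\<in>carrier ?G. y \<otimes>\<^bsub>?G\<^esub> x = \<one>\<^bsub>?G\<^esub>"
    by (rule bexI[of _ "(- (N *v v), N)"]) (use N in \<open>auto simp: SOL_def x\<close>)
qed (auto simp: SOL_def SOL_diag_one SOL_diag_mult matrix_mul_assoc matrix_vector_mul_assoc
       matrix_vector_right_distrib add.assoc)


section \<open>Cocompact lattices\<close>

text \<open>The space \<open>G/H\<close> of left cosets with the quotient topology.\<close>

definition coset_space :: "'a topology \<Rightarrow> ('a, 'b) monoid_scheme \<Rightarrow> 'a set \<Rightarrow> 'a set topology" where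
  "coset_space T G H = topology (\<lambda>U. U \<subseteq> lcosets\<^bsub>G\<^esub> H \<and> openin T (\<Union>U))"

lemma openin_coset_space:
  assumes "group G" "subgroup H G"
  shows "openin (coset_space T G H) U \<longleftrightarrow> U \<subseteq> lcosets\<^bsub>G\<^esub> H \<and> openin T (\<Union>U)"
proof -
  interpret group G by fact
  have disj: "A = B" if "A \<in> lcosets\<^bsub>G\<^esub> H" "B \<in> lcosets\<^bsub>G\<^esub> H" "x \<in> A" "x \<in> B" for A B x
    using lcos_disjoint[OF assms(2)] that by blast
  have "istopology (\<lambda>U. U \<subseteq> lcosets\<^bsub>G\<^esub> H \<and> openin T (\<Union>U))"
    unfolding istopology_def
  proof (intro conjI allI impI)
    fix U V assume U: "U \<subseteq> lcosets\<^bsub>G\<^esub> H \<and> openin T (\<Union>U)"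
      and V: "V \<subseteq> lcosets\<^bsub>G\<^esub> H \<and> openin T (\<Union>V)"
    have "\<Union>(U \<inter> V) = \<Union>U \<inter> \<Union>V"
      using U V disj by blast
    then show "openin T (\<Union>(U \<inter> V))" using U V by auto
    show "U \<inter> V \<subseteq> lcosets\<^bsub>G\<^esub> H" using U by blast
  next
    fix \<U> assume \<U>: "\<forall>U\<in>\<U>. U \<subseteq> lcosets\<^bsub>G\<^esub> H \<and> openin T (\<Union>U)"
    then show "\<Union>\<U> \<subseteq> lcosets\<^bsub>G\<^esub> H" by blast
    have "\<Union>(\<Union>\<U>) = \<Union>(Union ` \<U>)" by blast
    with \<U> show "openin T (\<Union>(\<Union>\<U>))" by auto
  qed
  then show ?thesis unfolding coset_space_def by simp
qed

definition cocompact_lattice :: "'a topology \<Rightarrow> ('a, 'b) monoid_scheme \<Rightarrow> 'a set \<Rightarrow> bool" where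
  "cocompact_lattice T G H \<longleftrightarrow>
     subgroup H G \<and> subtopology T H = discrete_topology H \<and> compact_space (coset_space T G H)"

end

theory Submission
  imports Defs
begin

text \<open>Let \<open>R = F_p[t, 1/t, 1/(t+1)]\<close>. Sending \<open>a\<close> to the translation by \<open>1\<close> and \<open>s\<close>, \<open>t\<close> to the diagonal
  maps \<open>1/(t+1)\<close>, \<open>1/t\<close> embeds the group as \<open>R\<close> extended by two units of infinite order. The relations
  make the conjugates of \<open>a\<close> commute, so that every word has a normal form
  \<open>s^k t^i f s^l t^j\<close> with \<open>f\<close> a polynomial over \<open>F_p\<close>; this normal form can be read off in
  \<open>SOL5\<close>, whence injectivity. The three coordinates of \<open>SOL5\<close> are the completions of \<open>F_p(t)\<close> at
  \<open>0\<close>, \<open>-1\<close> and \<open>\<infinity>\<close>: discreteness is the product formula, and cocompactness is the decomposition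
  of a triple of Laurent series into principal parts, which lie in \<open>R\<close>, and integral parts, which
  range over a compact set.\<close>

subsection \<open>Words and presentations\<close>

primrec word_val :: "('a, 'b) monoid_scheme \<Rightarrow> ('g \<Rightarrow> 'a) \<Rightarrow> 'g word \<Rightarrow> 'a" where
  "word_val G \<phi> [] = \<one>\<^bsub>G\<^esub>"
| "word_val G \<phi> (l # w) =
     (if snd l then \<phi> (fst l) else inv\<^bsub>G\<^esub> (\<phi> (fst l))) \<otimes>\<^bsub>G\<^esub> word_val G \<phi> w"

context group
begin

lemma word_val_closed [simp]:
  assumes "\<And>x. \<phi> x \<in> carrier G"
  shows "word_val G \<phi> w \<in> carrier G"
  using assms by (induction w) auto

lemma word_val_append:
  assumes "\<And>x. \<phi> x \<in> carrier G"
  shows "word_val G \<phi> (u @ v) = word_val G \<phi> u \<otimes> word_val G \<phi> v"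
  using assms by (induction u) (auto simp: m_assoc)

lemma word_val_free_eq:
  assumes \<phi>: "\<And>x. \<phi> x \<in> carrier G" and "free_eq u v"
  shows "word_val G \<phi> u = word_val G \<phi> v"
  using assms(2)
proof (induction rule: free_eq.induct)
  case (free_eq_cancel u x e v)
  have "word_val G \<phi> [(x, e), (x, \<not> e)] = \<one>"
    using \<phi> by (cases e) auto
  then show ?case
    using \<phi> by (simp only: word_val_append word_val_closed l_one)
qed auto

end

text \<open>Words in one free class have the same value by \<open>word_val_free_eq\<close>, so the
  choice of representative does not matter.\<close>

definition free_lift :: "('a, 'b) monoid_scheme \<Rightarrow> ('g \<Rightarrow> 'a) \<Rightarrow> 'g word set \<Rightarrow> 'a" where
  "free_lift G \<phi> A = word_val G \<phi> (SOME u. u \<in> A)"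

context group
begin

lemma free_lift_class:
  assumes "\<And>x. \<phi> x \<in> carrier G"
  shows "free_lift G \<phi> (free_class u) = word_val G \<phi> u"
proof -
  have "(SOME v. v \<in> free_class u) \<in> free_class u"
    by (rule someI[of _ u]) (simp add: free_class_def free_eq_refl)
  then show ?thesis
    using word_val_free_eq[OF assms, of u] unfolding free_lift_def free_class_def by simp
qed

lemma free_lift_hom:
  assumes "\<And>x. \<phi> x \<in> carrier G"
  shows "free_lift G \<phi> \<in> hom free_group G"
  using assms
  by (auto simp: hom_def free_group_carrier free_lift_class free_group_mult word_val_append)

lemma free_lift_gen:
  assumes "\<And>x. \<phi> x \<in> carrier G"
  shows "free_lift G \<phi> (free_gen x) = \<phi> x"
  using assms by (simp add: free_gen_def free_lift_class)

text \<open>Covers homomorphisms that are not built by \<open>free_lift\<close>, above all the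
  projection onto \<open>Lambda\<close>: they too are determined by the images of the
  generators.\<close>

lemma hom_free_class:
  assumes "h \<in> hom free_group G"
  shows "h (free_class w) = word_val G (\<lambda>x. h (free_gen x)) w"
proof -
  interpret F: group "free_group :: 'c word set monoid" by (rule group_free_group)
  interpret h: group_hom free_group G h by standard (rule assms)
  have gen: "free_gen x \<in> carrier free_group" for x :: 'c
    by (simp add: free_gen_def free_group_carrier)
  have inv_gen: "inv\<^bsub>free_group\<^esub> (free_gen x) = free_class [(x, False)]" for x :: 'c
    using free_eq_cancel[of "[]" x False "[]"]
    by (intro F.inv_equality)
      (auto simp: free_gen_def free_group_mult free_group_carrier free_group_one free_class_eq_iff)
  show ?thesis
  proof (induction w)
    case Nil
    then show ?case by (simp flip: free_group_one)
  next
    case (Cons l w)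
    have "free_class [l] = (if snd l then free_gen (fst l) else inv\<^bsub>free_group\<^esub> free_gen (fst l))"
      by (cases l) (simp add: inv_gen, simp add: free_gen_def)
    moreover have "free_class (l # w) = free_class [l] \<otimes>\<^bsub>free_group\<^esub> free_class w"
      by (simp add: free_group_mult)
    ultimately show ?case
      using Cons gen by (cases "snd l") (simp_all add: free_group_carrier del: F.inv_closed
          add: F.inv_closed[OF gen, unfolded free_group_carrier])
  qed
qed

end

lemma (in group_hom) hom_conjugate:
  "x \<in> carrier G \<Longrightarrow> y \<in> carrier G \<Longrightarrow> h (conjugate G x y) = conjugate H (h x) (h y)"
  by (simp add: conjugate_def)

lemma (in group_hom) hom_commutator:
  "x \<in> carrier G \<Longrightarrow> y \<in> carrier G \<Longrightarrow> h (commutator G x y) = commutator H (h x) (h y)"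
  by (simp add: commutator_def)

lemma (in group) conjugate_closed [simp]:
  "x \<in> carrier G \<Longrightarrow> g \<in> carrier G \<Longrightarrow> conjugate G x g \<in> carrier G"
  by (simp add: conjugate_def)

lemma (in group) commutator_eq_one_iff:
  assumes "x \<in> carrier G" "y \<in> carrier G"
  shows "commutator G x y = \<one> \<longleftrightarrow> x \<otimes> y = y \<otimes> x"
  using assms unfolding commutator_def
  by (metis inv_closed inv_equality inv_inv inv_mult_group m_assoc m_closed r_inv)

text \<open>Stated for an arbitrary group, so that one normal form computation serves both
  \<open>SOL\<close> and the presented group itself. The prime enters as a type, which makes
  \<open>'p mod_ring\<close> available as coefficient field.\<close>

locale Lambda_relations = group G for G (structure) +
  fixes a s t :: 'a and prime_type :: "'p::prime_card itself"
  assumes gens_closed [simp]: "a \<in> carrier G" "s \<in> carrier G" "t \<in> carrier G"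
    and a_pow_p: "a [^] CARD('p) = \<one>"
    and s_t: "commutator G s t = \<one>"
    and a_t_a: "commutator G (conjugate G a t) a = \<one>"
    and a_s: "conjugate G a s \<otimes> inv (conjugate G a t \<otimes> a) = \<one>"

text \<open>Translates relators into relations between images; applied to the map into
  \<open>SOL\<close> and to the projection onto \<open>Lambda\<close>.\<close>

lemma hom_image_Lambda_relators:
  assumes "group H" "h \<in> hom free_group H"
  defines "a \<equiv> h (free_gen Gen_a)" and "s \<equiv> h (free_gen Gen_s)" and "t \<equiv> h (free_gen Gen_t)"
  shows "h ` Lambda_relators p =
    {a [^]\<^bsub>H\<^esub> p, commutator H s t, commutator H (conjugate H a t) a,
     conjugate H a s \<otimes>\<^bsub>H\<^esub> inv\<^bsub>H\<^esub> (conjugate H a t \<otimes>\<^bsub>H\<^esub> a)}"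
proof -
  interpret F: group "free_group :: gen word set monoid" by (rule group_free_group)
  interpret group_hom free_group H h
    using assms by (simp add: group_hom_def group_hom_axioms_def F.is_group)
  have "free_gen x \<in> carrier free_group" for x :: gen
    by (simp add: free_gen_def free_group_carrier)
  then show ?thesis
    by (simp add: Lambda_relators_def Let_def hom_conjugate hom_commutator hom_nat_pow
        a_def s_def t_def)
qed

subsection \<open>Normal forms in groups satisfying the relations\<close>

lemma (in group) mult_conjugate:
  "x \<in> carrier G \<Longrightarrow> g \<in> carrier G \<Longrightarrow> g \<otimes> conjugate G x g = x \<otimes> g"
  by (simp add: conjugate_def flip: m_assoc)

lemma (in group) conjugate_one [simp]: "g \<in> carrier G \<Longrightarrow> conjugate G \<one> g = \<one>"
  by (simp add: conjugate_def)

lemma (in group) conjugate_mult: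
  assumes "x \<in> carrier G" "y \<in> carrier G" "g \<in> carrier G"
  shows "conjugate G (x \<otimes> y) g = conjugate G x g \<otimes> conjugate G y g"
proof -
  have "conjugate G x g \<otimes> conjugate G y g = inv g \<otimes> x \<otimes> (g \<otimes> (inv g \<otimes> (y \<otimes> g)))"
    using assms by (simp add: conjugate_def m_assoc)
  also have "g \<otimes> (inv g \<otimes> (y \<otimes> g)) = y \<otimes> g"
    using assms by (simp flip: m_assoc)
  also have "inv g \<otimes> x \<otimes> (y \<otimes> g) = conjugate G (x \<otimes> y) g"
    using assms by (simp add: conjugate_def m_assoc)
  finally show ?thesis ..
qed

lemma (in group) conjugate_conjugate:
  assumes "x \<in> carrier G" "g \<in> carrier G" "h \<in> carrier G"
  shows "conjugate G (conjugate G x g) h = conjugate G x (g \<otimes> h)"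
  using assms by (simp add: conjugate_def inv_mult_group m_assoc)

lemma (in group) conjugate_hom: "g \<in> carrier G \<Longrightarrow> (\<lambda>x. conjugate G x g) \<in> hom G G"
  by (auto simp: hom_def conjugate_mult)

lemma (in group) conjugate_int_pow:
  assumes "x \<in> carrier G" "g \<in> carrier G"
  shows "conjugate G (x [^] (n::int)) g = conjugate G x g [^] n"
  using hom_int_pow[OF conjugate_hom] assms is_group by blast

lemma (in group) commute_mult:
  assumes "x \<in> carrier G" "y \<in> carrier G" "z \<in> carrier G" "x \<otimes> y = y \<otimes> x" "x \<otimes> z = z \<otimes> x"
  shows "x \<otimes> (y \<otimes> z) = y \<otimes> z \<otimes> x"
  using assms by (metis m_assoc)

text \<open>Commuting with \<open>x\<close> means being fixed under conjugation by \<open>x\<close>,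
  and conjugation is a homomorphism, so it fixes the powers as well.\<close>

lemma (in group) commute_int_pow:
  assumes x: "x \<in> carrier G" and y: "y \<in> carrier G" and comm: "x \<otimes> y = y \<otimes> x"
  shows "x \<otimes> y [^] (n::int) = y [^] n \<otimes> x"
proof -
  have "conjugate G y x = inv x \<otimes> (x \<otimes> y)"
    using x y comm by (simp add: conjugate_def m_assoc)
  also have "\<dots> = y"
    using x y by (simp flip: m_assoc)
  finally have "conjugate G y x = y" .
  then have "conjugate G (y [^] n) x = y [^] n"
    using x y by (simp add: conjugate_int_pow)
  then show ?thesis
    using mult_conjugate[of "y [^] n" x] x y by simp
qed

lemma (in group) commute_inv:
  assumes "x \<in> carrier G" "y \<in> carrier G" "x \<otimes> y = y \<otimes> x"
  shows "x \<otimes> inv y = inv y \<otimes> x"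
  using commute_int_pow[OF assms, of "- 1"] assms by (simp add: int_pow_neg)

lemma (in group) conjugate_commute:
  assumes "x \<in> carrier G" "y \<in> carrier G" "g \<in> carrier G" "x \<otimes> y = y \<otimes> x"
  shows "conjugate G x g \<otimes> conjugate G y g = conjugate G y g \<otimes> conjugate G x g"
  using assms by (simp flip: conjugate_mult)

context Lambda_relations
begin

abbreviation conj_t :: "'a \<Rightarrow> 'a" where "conj_t x \<equiv> conjugate G x t"
abbreviation conj_s :: "'a \<Rightarrow> 'a" where "conj_s x \<equiv> conjugate G x s"

lemma s_t_commute: "s \<otimes> t = t \<otimes> s"
  using s_t by (simp add: commutator_eq_one_iff)

lemma conj_s_t: "x \<in> carrier G \<Longrightarrow> conj_s (conj_t x) = conj_t (conj_s x)"
  by (simp add: conjugate_conjugate s_t_commute)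

lemma conj_s_a: "conj_s a = conj_t a \<otimes> a"
  using a_s by (metis conjugate_closed gens_closed inv_closed inv_equality inv_inv m_closed)

definition shift_a :: "nat \<Rightarrow> 'a" where
  "shift_a n = (conj_t ^^ n) a"

lemma shift_a_0: "shift_a 0 = a"
  and shift_a_Suc: "shift_a (Suc n) = conj_t (shift_a n)"
  by (simp_all add: shift_a_def)

lemma shift_a_closed [simp]: "shift_a n \<in> carrier G"
  by (induction n) (simp_all add: shift_a_def)

text \<open>The relation for \<open>a\<close>, transported by conjugation by \<open>t\<close>, which
  commutes with conjugation by \<open>s\<close>.\<close>

lemma conj_s_shift_a: "conj_s (shift_a n) = shift_a (Suc n) \<otimes> shift_a n"
  by (induction n) (simp_all add: shift_a_0 shift_a_Suc conj_s_a conj_s_t conjugate_mult)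

text \<open>Conjugating \<open>[a_0, a_n] = 1\<close> by \<open>s\<close> gives \<open>[a_1 a_0, a_(n+1) a_n] = 1\<close>, in which all pairs
  except \<open>a_0, a_(n+1)\<close> already commute.\<close>

lemma shift_a_commute_0: "a \<otimes> shift_a n = shift_a n \<otimes> a"
proof (induction n rule: less_induct)
  case (less n)
  have one: "shift_a 1 \<otimes> a = a \<otimes> shift_a 1"
    using a_t_a by (simp add: shift_a_def commutator_eq_one_iff)
  consider "n = 0" | "n = 1" | m where "n = Suc (Suc m)"
    by (metis One_nat_def not0_implies_Suc)
  then show ?case
  proof cases
    case 3
    let ?x = "shift_a (Suc m)" and ?y = "shift_a n" and ?b = "conj_t a"
    have ax: "a \<otimes> ?x = ?x \<otimes> a"
      using less 3 by simp
    \<comment> \<open>The commutations with \<open>?b\<close> are the induction hypothesis at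
      \<open>m\<close> and \<open>ax\<close>, each conjugated by \<open>t\<close>. Only
      \<open>a\<close> and \<open>?y\<close> remain in question, and \<open>?b\<close> and
      \<open>?x\<close> cancel at the end.\<close>
    have bx: "?b \<otimes> ?x = ?x \<otimes> ?b"
      using less[of m] 3 by (simp add: shift_a_Suc conjugate_commute)
    have b_y: "?b \<otimes> ?y = ?y \<otimes> ?b"
      using ax 3 by (simp add: shift_a_Suc[of "Suc m"] conjugate_commute)
    have "conj_s a \<otimes> conj_s ?x = conj_s ?x \<otimes> conj_s a"
      using ax by (intro conjugate_commute) auto
    then have "?b \<otimes> a \<otimes> (?y \<otimes> ?x) = ?y \<otimes> ?x \<otimes> (?b \<otimes> a)"
      using conj_s_shift_a[of "Suc m"] conj_s_a 3 by simp
    also have "\<dots> = ?y \<otimes> (?b \<otimes> ?x) \<otimes> a"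
      by (simp add: m_assoc bx)
    also have "\<dots> = ?b \<otimes> ?y \<otimes> (?x \<otimes> a)"
      by (simp add: b_y m_assoc)
    also have "\<dots> = ?b \<otimes> (?y \<otimes> a \<otimes> ?x)"
      by (simp add: m_assoc flip: ax)
    finally have "?b \<otimes> (a \<otimes> ?y \<otimes> ?x) = ?b \<otimes> (?y \<otimes> a \<otimes> ?x)"
      by (simp add: m_assoc)
    then show ?thesis
      by simp
  qed (use one in \<open>simp_all add: shift_a_0\<close>)
qed

text \<open>The product of the \<open>shift_a i\<close> raised to the \<open>i\<close>-th coefficient of \<open>f\<close>, in Horner form.\<close>

definition lamp :: "'p mod_ring poly \<Rightarrow> 'a" where
  "lamp f = fold_coeffs (\<lambda>c x. a [^] to_int_mod_ring c \<otimes> conj_t x) f \<one>"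

lemma lamp_0 [simp]: "lamp 0 = \<one>"
  by (simp add: lamp_def)

lemma lamp_pCons: "lamp (pCons c f) = a [^] to_int_mod_ring c \<otimes> conj_t (lamp f)"
  by (cases "c = 0 \<and> f = 0") (auto simp: lamp_def)

lemma lamp_closed [simp]: "lamp f \<in> carrier G"
  by (induction f) (simp_all add: lamp_pCons)

lemma lamp_1: "lamp 1 = a"
  by (simp add: one_pCons lamp_pCons)

lemma a_lamp_commute: "a \<otimes> lamp f = lamp f \<otimes> a"
proof -
  have closed: "(conj_t ^^ n) x \<in> carrier G" if "x \<in> carrier G" for x n
    using that by (induction n) auto
  have mult: "(conj_t ^^ n) (x \<otimes> y) = (conj_t ^^ n) x \<otimes> (conj_t ^^ n) y"
    if "x \<in> carrier G" "y \<in> carrier G" for x y n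
    using that by (induction n) (auto simp: conjugate_mult closed)
  have pow: "(conj_t ^^ n) (a [^] c) = shift_a n [^] (c::int)" for n c
    by (induction n) (auto simp: shift_a_0 shift_a_Suc conjugate_int_pow)
  \<comment> \<open>Stated for all shifts \<open>n\<close> at once, because each Horner step puts
    the remaining polynomial under one further conjugation by \<open>t\<close>.\<close>
  have "a \<otimes> (conj_t ^^ n) (lamp f) = (conj_t ^^ n) (lamp f) \<otimes> a" for n
  proof (induction f arbitrary: n)
    case 0
    have "(conj_t ^^ n) \<one> = \<one>"
      by (induction n) auto
    then show ?case by simp
  next
    case (pCons c f)
    have "(conj_t ^^ n) (lamp (pCons c f)) =
        shift_a n [^] to_int_mod_ring c \<otimes> (conj_t ^^ Suc n) (lamp f)"
      by (simp add: lamp_pCons mult pow funpow_Suc_right del: funpow.simps)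
    then show ?case
      using pCons.IH[of "Suc n"]
      by (simp add: commute_mult commute_int_pow shift_a_commute_0 closed del: funpow.simps)
  qed
  from this[of 0] show ?thesis by simp
qed

lemma lamp_pow_commute: "a [^] (n::int) \<otimes> lamp f = lamp f \<otimes> a [^] n"
  by (simp add: commute_int_pow a_lamp_commute[symmetric])

lemma lamp_pCons_0: "lamp (pCons 0 f) = conj_t (lamp f)"
  by (simp add: lamp_pCons)

lemma a_pow_mod: "a [^] (n mod int CARD('p)) = a [^] n"
proof -
  have "a [^] (int CARD('p) * (n div int CARD('p))) = \<one>"
    using a_pow_p by (simp add: int_pow_int flip: int_pow_pow)
  then have "a [^] (int CARD('p) * (n div int CARD('p)) + n mod int CARD('p)) = a [^] (n mod int CARD('p))"
    by (simp only: int_pow_mult gens_closed) simp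
  then show ?thesis by simp
qed

text \<open>Powers of \<open>a\<close> move past \<open>conj_t (lamp f)\<close>, itself a value of
  \<open>lamp\<close>, so the coefficients merge one at a time.\<close>

lemma lamp_add: "lamp (f + g) = lamp f \<otimes> lamp g"
proof (induction f g rule: poly_induct2)
  case (pCons c f d g)
  let ?c = "to_int_mod_ring c" and ?d = "to_int_mod_ring d"
  \<comment> \<open>The sum of two representatives may reach \<open>p\<close> or more;
    \<open>a_pow_mod\<close> absorbs the reduction.\<close>
  have "to_int_mod_ring (c + d) = (?c + ?d) mod int CARD('p)"
    by transfer simp
  then have "lamp (pCons c f + pCons d g) = a [^] (?c + ?d) \<otimes> conj_t (lamp f \<otimes> lamp g)"
    using pCons by (simp add: lamp_pCons a_pow_mod)
  also have "\<dots> = a [^] ?c \<otimes> (a [^] ?d \<otimes> lamp (pCons 0 f)) \<otimes> lamp (pCons 0 g)"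
    by (simp add: int_pow_mult conjugate_mult lamp_pCons m_assoc)
  also have "\<dots> = lamp (pCons c f) \<otimes> lamp (pCons d g)"
    unfolding lamp_pow_commute by (simp add: lamp_pCons m_assoc)
  finally show ?case .
qed simp

lemma lamp_uminus: "lamp (- f) = inv (lamp f)"
  using lamp_add[of "- f" f] by (simp add: inv_equality)

lemma conj_s_lamp: "conj_s (lamp f) = lamp ([:1, 1:] * f)"
proof -
  \<comment> \<open>On powers of \<open>a\<close> this is the relation \<open>a^s = a^t a\<close>;
    it extends to products because all factors commute. The right-hand side is \<open>lamp\<close>
    of \<open>f\<close> plus its shift, that is of \<open>(1 + X) f\<close>.\<close>
  have "conj_s (lamp f) = lamp f \<otimes> conj_t (lamp f)"
  proof (induction f)
    case (pCons c f)
    let ?n = "to_int_mod_ring c" and ?x = "conj_t (lamp f)"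
    have "conj_t a \<otimes> a = a \<otimes> conj_t a"
      using shift_a_commute_0[of 1] by (simp add: shift_a_def)
    then have A: "conj_s (a [^] ?n) = a [^] ?n \<otimes> conj_t (a [^] ?n)"
      by (simp add: conj_s_a int_pow_mult_distrib conjugate_int_pow)
    have B: "conj_t (a [^] ?n) \<otimes> ?x = ?x \<otimes> conj_t (a [^] ?n)"
      by (intro conjugate_commute) (simp_all add: lamp_pow_commute)
    have "conj_s (a [^] ?n) \<otimes> (?x \<otimes> conj_t ?x)
        = a [^] ?n \<otimes> (conj_t (a [^] ?n) \<otimes> ?x) \<otimes> conj_t ?x"
      by (simp add: A m_assoc)
    also have "\<dots> = a [^] ?n \<otimes> ?x \<otimes> (conj_t (a [^] ?n) \<otimes> conj_t ?x)"
      unfolding B by (simp add: m_assoc)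
    finally have "conj_s (a [^] ?n) \<otimes> (?x \<otimes> conj_t ?x)
        = a [^] ?n \<otimes> ?x \<otimes> (conj_t (a [^] ?n) \<otimes> conj_t ?x)" .
    then show ?case
      using pCons by (simp add: lamp_pCons conjugate_mult conj_s_t m_assoc)
  qed simp
  then show ?thesis by (simp add: lamp_add lamp_pCons_0)
qed

end

text \<open>The tuple \<open>(k, i, f, l, j)\<close> stands for \<open>s^k t^i (lamp f) s^l t^j\<close>. The exponents \<open>k\<close> and \<open>i\<close>
  are natural numbers so that conjugating \<open>a\<close> by \<open>s^k t^i\<close> gives the polynomial \<open>(1 + X)^k X^i\<close>.\<close>

type_synonym 'p normal_form = "nat \<times> nat \<times> 'p mod_ring poly \<times> int \<times> int"

text \<open>Left multiplication by one letter. An inverse letter moves through the left powers and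
  through \<open>lamp f\<close>, multiplying \<open>f\<close> by \<open>1 + X\<close> or
  \<open>X\<close>, and lowers only the right exponent; this keeps \<open>k\<close> and
  \<open>i\<close> natural. A letter \<open>a\<close> moves past \<open>s^k t^i\<close> into the
  polynomial.\<close>

fun nf_step :: "gen \<times> bool \<Rightarrow> ('p::prime_card) normal_form \<Rightarrow> 'p normal_form" where
  "nf_step (Gen_s, True) (k, i, f, l, j) = (Suc k, i, f, l, j)"
| "nf_step (Gen_s, False) (k, i, f, l, j) = (k, i, [:1, 1:] * f, l - 1, j)"
| "nf_step (Gen_t, True) (k, i, f, l, j) = (k, Suc i, f, l, j)"
| "nf_step (Gen_t, False) (k, i, f, l, j) = (k, i, pCons 0 f, l, j - 1)"
| "nf_step (Gen_a, e) (k, i, f, l, j) =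
     (k, i, (if e then 1 else - 1) * [:1, 1:] ^ k * [:0, 1:] ^ i + f, l, j)"

definition nf :: "gen word \<Rightarrow> ('p::prime_card) normal_form" where
  "nf w = foldr nf_step w (0, 0, 0, 0, 0)"

context Lambda_relations
begin

fun nf_val :: "'p normal_form \<Rightarrow> 'a" where
  "nf_val (k, i, f, l, j) = s [^] k \<otimes> t [^] i \<otimes> lamp f \<otimes> s [^] l \<otimes> t [^] j"

lemma conj_s_pow_lamp: "conjugate G (lamp f) (s [^] (k::nat)) = lamp ([:1, 1:] ^ k * f)"
proof (induction k)
  case (Suc k)
  have "conjugate G (lamp f) (s [^] Suc k) = conj_s (conjugate G (lamp f) (s [^] k))"
    by (simp add: conjugate_conjugate)
  also have "\<dots> = lamp ([:1, 1:] * ([:1, 1:] ^ k * f))"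
    unfolding Suc by (rule conj_s_lamp)
  finally show ?case
    by (simp only: power_Suc mult.assoc)
qed (simp add: conjugate_def)

lemma conj_t_pow_lamp: "conjugate G (lamp f) (t [^] (i::nat)) = lamp ([:0, 1:] ^ i * f)"
proof (induction i)
  case (Suc i)
  have "conjugate G (lamp f) (t [^] Suc i) = conj_t (conjugate G (lamp f) (t [^] i))"
    by (simp add: conjugate_conjugate)
  also have "\<dots> = lamp (pCons 0 ([:0, 1:] ^ i * f))"
    unfolding Suc by (rule lamp_pCons_0[symmetric])
  finally show ?case
    by simp
qed (simp add: conjugate_def)

lemma nf_val_step:
  "nf_val (nf_step l n) =
     (if snd l then case_gen a s t (fst l) else inv (case_gen a s t (fst l))) \<otimes> nf_val n"
proof -
  obtain k i f m j where n: "n = (k, i, f, m, j)"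
    by (cases n) auto
  obtain z e where l: "l = (z, e)"
    by fastforce
  let ?g = "s [^] k \<otimes> t [^] i" and ?h = "s [^] m \<otimes> t [^] j"
  have val: "nf_val (k', i', f', m', j') = s [^] k' \<otimes> t [^] i' \<otimes> lamp f' \<otimes> (s [^] m' \<otimes> t [^] j')"
    for k' i' f' m' j'
    by (simp add: m_assoc)
  have comm_pow: "x \<otimes> y [^] (q::nat) = y [^] q \<otimes> x"
    if "x \<in> carrier G" "y \<in> carrier G" "x \<otimes> y = y \<otimes> x" for x y q
    using commute_int_pow[OF that, of "int q"] by (simp add: int_pow_int)
  have sg: "s \<otimes> ?g = ?g \<otimes> s" and tg: "t \<otimes> ?g = ?g \<otimes> t"
    by (intro commute_mult comm_pow; simp add: s_t_commute)+
  \<comment> \<open>Inserting \<open>y\<close> and its inverse behind \<open>x\<close> conjugates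
    the middle factor; the leftover inverse joins \<open>?h\<close>.\<close>
  have inv_step: "inv y \<otimes> (?g \<otimes> x \<otimes> ?h) = ?g \<otimes> conjugate G x y \<otimes> (inv y \<otimes> ?h)"
    if y: "y \<in> carrier G" "y \<otimes> ?g = ?g \<otimes> y" and x: "x \<in> carrier G" for x y
  proof -
    have "?g \<otimes> inv y = inv y \<otimes> ?g"
      using y by (intro commute_inv) auto
    then have "inv y \<otimes> (?g \<otimes> x \<otimes> ?h) = ?g \<otimes> inv y \<otimes> x \<otimes> ?h"
      using x y by (simp add: m_assoc)
    also have "\<dots> = ?g \<otimes> inv y \<otimes> x \<otimes> (y \<otimes> inv y) \<otimes> ?h"
      using x y by simp
    also have "\<dots> = ?g \<otimes> conjugate G x y \<otimes> (inv y \<otimes> ?h)"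
      using x y by (simp only: conjugate_def m_assoc m_closed inv_closed gens_closed
          int_pow_closed nat_pow_closed)
    finally show ?thesis .
  qed
  have pow: "x [^] (q - 1) = inv x \<otimes> x [^] q" if "x \<in> carrier G" for x :: 'a and q :: int
    using int_pow_mult[OF that, of "-1" q] that by (simp add: int_pow_neg)
  have inv_t: "inv t \<otimes> s [^] m = s [^] m \<otimes> inv t"
    by (intro commute_int_pow commute_inv[symmetric]) (simp_all add: s_t_commute)
  \<comment> \<open>The letter crosses \<open>?g\<close> as a conjugate, which by the power rules is
    \<open>lamp\<close> of \<open>c (1 + X)^k X^i\<close>.\<close>
  have a_step: "lamp (c * [:1, 1:] ^ k * [:0, 1:] ^ i + f) = conjugate G (lamp c) ?g \<otimes> lamp f" for c
    by (simp add: lamp_add conj_s_pow_lamp conj_t_pow_lamp mult_ac flip: conjugate_conjugate)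
  have a_step': "?g \<otimes> (conjugate G x ?g \<otimes> y) \<otimes> ?h = x \<otimes> (?g \<otimes> y \<otimes> ?h)"
    if "x \<in> carrier G" "y \<in> carrier G" for x y
  proof -
    have "?g \<otimes> (conjugate G x ?g \<otimes> y) \<otimes> ?h = ?g \<otimes> conjugate G x ?g \<otimes> (y \<otimes> ?h)"
      using that by (simp add: m_assoc)
    also have "\<dots> = x \<otimes> (?g \<otimes> y \<otimes> ?h)"
      using that by (simp add: mult_conjugate) (simp add: m_assoc)
    finally show ?thesis .
  qed
  show ?thesis
  proof (cases z)
    case Gen_a
    have "lamp (if e then 1 else - 1) = (if e then a else inv a)"
      by (simp add: lamp_1 lamp_uminus)
    then show ?thesis
      unfolding n l Gen_a nf_step.simps val a_step by (simp add: a_step')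
  next
    case Gen_s
    show ?thesis
    proof (cases e)
      case True
      then show ?thesis
        unfolding n l Gen_s using nat_pow_Suc2[of s k] by (simp add: m_assoc del: nat_pow_Suc)
    next
      case False
      then show ?thesis
        unfolding n l Gen_s using inv_step[of s "lamp f"] sg
        by (simp add: val conj_s_lamp pow m_assoc del: nf_val.simps mult_pCons_left)
    qed
  next
    case Gen_t
    show ?thesis
    proof (cases e)
      case True
      have "nf_val (k, Suc i, f, m, j) = ?g \<otimes> t \<otimes> lamp f \<otimes> ?h"
        by (simp add: m_assoc)
      also have "\<dots> = t \<otimes> nf_val n"
        unfolding n val tg[symmetric] by (simp add: m_assoc)
      finally show ?thesis
        using True by (simp add: n l Gen_t)
    next
      case False
      have "inv t \<otimes> ?h = s [^] m \<otimes> t [^] (j - 1)"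
        using inv_t by (simp add: pow flip: m_assoc)
      then show ?thesis
        unfolding n l Gen_t using inv_step[of t "lamp f"] tg False
        by (simp add: val lamp_pCons_0 del: nf_val.simps)
    qed
  qed
qed

lemma word_val_nf: "word_val G (case_gen a s t) w = nf_val (nf w)"
  by (induction w) (simp_all add: nf_def nf_val_step)

end

subsection \<open>Evaluation of polynomials at Laurent series\<close>

definition peval :: "'k::field poly \<Rightarrow> 'k fls \<Rightarrow> 'k fls" where
  "peval f x = poly (map_poly fls_const f) x"

lemma peval_0 [simp]: "peval 0 x = 0"
  by (simp add: peval_def)

lemma peval_pCons [simp]: "peval (pCons c f) x = fls_const c + x * peval f x"
  by (simp add: peval_def Polynomial.map_poly_pCons)

lemma peval_add: "peval (f + g) x = peval f x + peval g x"
  by (induction f g rule: poly_induct2) (simp_all add: fls_plus_const[symmetric] algebra_simps)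

lemma peval_smult: "peval (Polynomial.smult c f) x = fls_const c * peval f x"
  by (induction f) (simp_all add: algebra_simps)

lemma peval_uminus: "peval (- f) x = - peval f x"
  using peval_add[of "- f" f x] by (simp add: eq_neg_iff_add_eq_0)

lemma peval_mult: "peval (f * g) x = peval f x * peval g x"
  by (induction f) (simp_all add: peval_add peval_smult algebra_simps)

lemma peval_1 [simp]: "peval 1 x = 1"
  by (simp add: one_pCons)

lemma peval_power: "peval (f ^ n) x = peval f x ^ n"
  by (induction n) (simp_all add: peval_mult)

text \<open>Evaluation at \<open>1/X\<close> reflects the coefficients; this reads off the pole at
  infinity and lets polynomials stand for principal parts.\<close>

lemma fls_nth_peval_X_inv:
  "fls_nth (peval f fls_X_inv) n = (if n \<le> 0 then poly.coeff f (nat (- n)) else 0)"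
proof (induction f arbitrary: n)
  case (pCons c f)
  have "nat (- n) = Suc (nat (- (n + 1)))" if "n < 0"
    using that by linarith
  then show ?case
    using pCons by (auto simp: fls_X_inv_times_conv_shift coeff_pCons split: nat.splits)
qed simp

lemma fls_subdegree_nonneg_iff: "fls_subdegree f \<ge> 0 \<longleftrightarrow> (\<forall>n<0. fls_nth f n = 0)"
  by (auto intro: fls_subdegree_ge0I)

lemma fls_integral_add:
  "fls_subdegree f \<ge> 0 \<Longrightarrow> fls_subdegree g \<ge> 0 \<Longrightarrow> fls_subdegree (f + g) \<ge> 0"
  by (simp add: fls_subdegree_nonneg_iff)

lemma fls_integral_diff:
  "fls_subdegree f \<ge> 0 \<Longrightarrow> fls_subdegree g \<ge> 0 \<Longrightarrow> fls_subdegree (f - g) \<ge> 0"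
  for f g :: "'k::group_add fls"
  by (simp add: fls_subdegree_nonneg_iff)

lemma fls_integral_mult:
  "fls_subdegree f \<ge> 0 \<Longrightarrow> fls_subdegree g \<ge> 0 \<Longrightarrow> fls_subdegree (f * g) \<ge> 0"
  for f g :: "'k::field fls"
  by (cases "f = 0 \<or> g = 0") auto

lemma fls_integral_peval: "fls_subdegree x \<ge> 0 \<Longrightarrow> fls_subdegree (peval f x) \<ge> 0"
  by (induction f) (simp_all add: fls_integral_add fls_integral_mult)

text \<open>Evaluated at \<open>1/X\<close>, \<open>fls_prpart f\<close> reproduces the coefficients
  of \<open>f\<close> at negative indices, so these cancel.\<close>

lemma fls_integral_diff_prpart:
  "fls_subdegree (f - peval (fls_prpart f) fls_X_inv) \<ge> 0"
  by (auto simp: fls_subdegree_nonneg_iff fls_nth_peval_X_inv)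

subsection \<open>The three places\<close>

text \<open>The completions of the rational function field at \<open>t = 0\<close>, \<open>t = -1\<close> and \<open>t = \<infinity>\<close>, with
  uniformisers \<open>t\<close>, \<open>t + 1\<close> and \<open>1/t\<close>: the images of \<open>t\<close> and of \<open>t + 1\<close>.\<close>

definition place_t :: "'k::field fls ^ 3" where
  "place_t = vector [fls_X, fls_X - 1, fls_X_inv]"

definition place_t1 :: "'k::field fls ^ 3" where
  "place_t1 = vector [fls_X + 1, fls_X, fls_X_inv + 1]"

lemma place_t1_eq: "place_t1 = place_t + 1"
  by (simp add: vec_eq_iff forall_3 place_t_def place_t1_def)

lemma place_t1_nth: "place_t1 $ c = place_t $ c + 1"
  by (simp add: place_t1_eq)

lemma subdegree_place_t:
  "fls_subdegree (place_t $ 1 :: 'k::field fls) = 1"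
  "fls_subdegree (place_t $ 2 :: 'k fls) = 0"
  "fls_subdegree (place_t $ 3 :: 'k fls) = - 1"
  by (auto simp: place_t_def intro!: fls_subdegree_eqI)

lemma subdegree_place_t1:
  "fls_subdegree (place_t1 $ 1 :: 'k::field fls) = 0"
  "fls_subdegree (place_t1 $ 2 :: 'k fls) = 1"
  "fls_subdegree (place_t1 $ 3 :: 'k fls) = - 1"
  by (auto simp: place_t1_def intro!: fls_subdegree_eqI)

lemma place_nonzero [simp]: "place_t $ c \<noteq> (0 :: 'k::field fls)" "place_t1 $ c \<noteq> (0 :: 'k fls)"
proof -
  have "(fls_X - 1 :: 'k fls) \<noteq> 0" "(fls_X + 1 :: 'k fls) \<noteq> 0" "(fls_X_inv + 1 :: 'k fls) \<noteq> 0"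
    by (auto simp: fls_eq_iff intro!: exI[of _ 0])
  then show "place_t $ c \<noteq> (0 :: 'k::field fls)" "place_t1 $ c \<noteq> (0 :: 'k fls)"
    using exhaust_3[of c] by (auto simp: place_t_def place_t1_def)
qed

text \<open>With \<open>b = poly f r\<close> this makes a polynomial that does not vanish at
  \<open>r\<close> a unit at the place of \<open>r\<close>.\<close>

lemma fls_X_times_add_const:
  fixes h :: "'k::field fls"
  assumes "fls_subdegree h \<ge> 0" "b \<noteq> 0"
  shows "fls_subdegree (fls_X * h + fls_const b) = 0" "fls_X * h + fls_const b \<noteq> 0"
proof -
  have nth: "fls_nth (fls_X * h + fls_const b) 0 = b"
    "\<And>n. n < 0 \<Longrightarrow> fls_nth (fls_X * h + fls_const b) n = 0"
    using assms by (simp_all add: fls_X_times_conv_shift fls_subdegree_nonneg_iff)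
  then show "fls_subdegree (fls_X * h + fls_const b) = 0"
    using assms by (intro fls_subdegree_eqI) auto
  show "fls_X * h + fls_const b \<noteq> 0"
    using nth(1) assms(2) by (metis fls_zero_nth)
qed

text \<open>The factors \<open>t\<close> and \<open>t + 1\<close> have total valuation zero and are
  split off. What remains is a unit at both finite places, and at infinity its valuation is at most
  minus its degree. Only an inequality results because zeros elsewhere are not counted.\<close>

lemma place_product_formula:
  fixes f :: "'k::field poly"
  assumes "f \<noteq> 0"
  shows "(\<forall>c. peval f (place_t $ c) \<noteq> 0) \<and> (\<Sum>c\<in>UNIV. fls_subdegree (peval f (place_t $ c))) \<le> 0"
  using assms
proof (induction "degree f" arbitrary: f rule: less_induct)
  case less
  have peval_lin: "peval [:b, 1:] (place_t $ c) = place_t $ c + fls_const b" for b :: 'k and c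
    by (simp add: add.commute)
  show ?case
  proof (cases "\<exists>r\<in>{0, -1}. poly f r = 0")
    case True
    then obtain r where r: "r = 0 \<or> r = -1" "poly f r = 0" by blast
    then obtain g where g: "f = [:- r, 1:] * g"
      using poly_eq_0_iff_dvd by (metis dvdE)
    with less.prems have "g \<noteq> 0" by auto
    then have "degree f = Suc (degree g)"
      unfolding g by (subst degree_mult_eq) auto
    then have IH: "\<And>c. peval g (place_t $ c) \<noteq> 0"
        "(\<Sum>c\<in>UNIV. fls_subdegree (peval g (place_t $ c))) \<le> 0"
      using less.hyps[of g] \<open>g \<noteq> 0\<close> by auto
    have lin: "(\<forall>c. peval [:- r, 1:] (place_t $ c) \<noteq> 0) \<and>
        (\<Sum>c\<in>UNIV. fls_subdegree (peval [:- r, 1:] (place_t $ c))) = 0"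
      using r(1)
    proof
      assume "r = 0"
      then show ?thesis
        unfolding peval_lin by (simp add: sum_3 subdegree_place_t)
    next
      assume "r = -1"
      then have "peval [:- r, 1:] (place_t $ c) = place_t1 $ c" for c
        unfolding peval_lin by (simp add: place_t1_nth)
      then show ?thesis
        by (simp add: sum_3 subdegree_place_t1)
    qed
    show ?thesis
      unfolding g peval_mult using IH lin by (simp add: sum.distrib del: peval_pCons)
  next
    case False
    \<comment> \<open>Expansion around \<open>r\<close>: at the place of \<open>r\<close> the factor
      \<open>x - fls_const r\<close> is the uniformiser \<open>fls_X\<close>.\<close>
    have eq: "peval f x = (x - fls_const r) * peval (synthetic_div f r) x + fls_const (poly f r)"
      for x and r :: 'k
    proof -
      have "peval f x = peval ([:- r, 1:] * synthetic_div f r + [:poly f r:]) x"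
        by (simp only: synthetic_div_correct')
      then show ?thesis
        by (simp only: peval_add peval_mult) (simp add: algebra_simps)
    qed
    have 1: "peval f (place_t $ 1) \<noteq> 0" "fls_subdegree (peval f (place_t $ 1)) = 0"
      using fls_X_times_add_const[of "peval (synthetic_div f 0) fls_X" "poly f 0"] False
      by (simp_all add: eq[of _ 0] place_t_def fls_integral_peval)
    have "fls_subdegree (fls_X - 1 :: 'k fls) = 0"
      using subdegree_place_t(2) by (simp add: place_t_def)
    then have 2: "peval f (place_t $ 2) \<noteq> 0" "fls_subdegree (peval f (place_t $ 2)) = 0"
      using fls_X_times_add_const[of "peval (synthetic_div f (-1)) (fls_X - 1)" "poly f (-1)"] False
      by (simp_all add: eq[of _ "-1"] place_t_def fls_integral_peval)
    \<comment> \<open>At infinity the leading coefficient sits at index minus the degree.\<close>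
    have nth: "fls_nth (peval f (place_t $ 3)) (- int (degree f)) \<noteq> 0"
      using less.prems by (simp add: place_t_def fls_nth_peval_X_inv)
    then have "peval f (place_t $ 3) \<noteq> 0" by auto
    moreover have "fls_subdegree (peval f (place_t $ 3)) \<le> 0"
      using fls_subdegree_leI[OF nth] by linarith
    ultimately show ?thesis
      using 1 2 by (simp add: forall_3 sum_3)
  qed
qed

text \<open>Among the three places \<open>1/t\<close> has its only pole at the first,
  \<open>1/(t + 1)\<close> at the second and \<open>t\<close> at the third. Hence removing the
  principal part at one place changes the other two coordinates only by integral series.\<close>

lemma places_approximation:
  fixes x :: "'k::field fls ^ 3"
  shows "\<exists>f g h. \<forall>c::3. fls_subdegree (x $ c - (peval f (inverse (place_t $ c)) +
    peval g (inverse (place_t1 $ c)) + peval h (place_t $ c))) \<ge> 0"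
proof -
  have eqs: "inverse (place_t $ 1) = (fls_X_inv :: 'k fls)" "inverse (place_t1 $ 2) = (fls_X_inv :: 'k fls)"
    "place_t $ 3 = (fls_X_inv :: 'k fls)"
    by (simp_all add: place_t_def place_t1_def fls_inverse_X)
  have int: "fls_subdegree (inverse (place_t $ 2) :: 'k fls) \<ge> 0"
    "fls_subdegree (inverse (place_t $ 3) :: 'k fls) \<ge> 0"
    "fls_subdegree (inverse (place_t1 $ 1) :: 'k fls) \<ge> 0"
    "fls_subdegree (inverse (place_t1 $ 3) :: 'k fls) \<ge> 0"
    "fls_subdegree (place_t $ 1 :: 'k fls) \<ge> 0"
    "fls_subdegree (place_t $ 2 :: 'k fls) \<ge> 0"
    by (simp_all add: fls_inverse_subdegree subdegree_place_t subdegree_place_t1)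
  define f g h where "f = fls_prpart (x $ 1)" and "g = fls_prpart (x $ 2)" and "h = fls_prpart (x $ 3)"
  note defs = f_def[symmetric] g_def[symmetric] h_def[symmetric]
  note pr = fls_integral_diff_prpart[of "x $ 1", unfolded defs]
    fls_integral_diff_prpart[of "x $ 2", unfolded defs] fls_integral_diff_prpart[of "x $ 3", unfolded defs]
  have "fls_subdegree (x $ c - (peval f (inverse (place_t $ c)) +
    peval g (inverse (place_t1 $ c)) + peval h (place_t $ c))) \<ge> 0" for c
  proof -
    consider "c = 1" | "c = 2" | "c = 3" using exhaust_3 by blast
    then show ?thesis
    proof cases
      case 1
      have "fls_subdegree (x $ 1 - peval f fls_X_inv - peval g (inverse (place_t1 $ 1)) - peval h (place_t $ 1)) \<ge> 0"
        by (intro fls_integral_diff fls_integral_peval int pr)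
      then show ?thesis by (simp add: 1 eqs diff_diff_eq add_ac)
    next
      case 2
      have "fls_subdegree (x $ 2 - peval g fls_X_inv - peval f (inverse (place_t $ 2)) - peval h (place_t $ 2)) \<ge> 0"
        by (intro fls_integral_diff fls_integral_peval int pr)
      then show ?thesis by (simp add: 2 eqs diff_diff_eq add_ac)
    next
      case 3
      have "fls_subdegree (x $ 3 - peval h fls_X_inv - peval f (inverse (place_t $ 3)) - peval g (inverse (place_t1 $ 3))) \<ge> 0"
        by (intro fls_integral_diff fls_integral_peval int pr)
      then show ?thesis using eqs(3) by (simp add: 3 diff_diff_eq add_ac)
    qed
  qed
  then show ?thesis by blast
qed

subsection \<open>The topology of Laurent series\<close>

lemma dist_fls_less_iff:
  "dist f g < inverse (2 ^ n) \<longleftrightarrow> f = g \<or> fls_subdegree (f - g) > int n"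
  for f g :: "'k::group_add fls"
proof -
  have "inverse (2 ^ n) \<le> (1::real)"
    by (simp add: inverse_le_1_iff)
  moreover have "1 \<le> (2::real) ^ m" for m :: nat
    by simp
  ultimately have "\<not> 2 ^ m < inverse (2 ^ n :: real)" for m
    by (meson not_less order_trans)
  then show ?thesis
    unfolding dist_fls_def by simp linarith
qed

text \<open>The ring of integers is a continuous image of the compact product of countably many copies of
  the finite residue field.\<close>

lemma compact_fls_integers: "compact {f :: 'k::{finite,field} fls. fls_subdegree f \<ge> 0}"
proof -
  let ?P = "product_topology (\<lambda>_. discrete_topology UNIV) (UNIV :: nat set) :: (nat \<Rightarrow> 'k) topology"
  let ?F = "\<lambda>x :: nat \<Rightarrow> 'k. fps_to_fls (Abs_fps x)"
  have nth: "fls_nth (?F x) k = (if k < 0 then 0 else x (nat k))" for x k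
    by simp
  have "continuous_map ?P euclidean ?F"
    unfolding continuous_map_def
  proof (intro conjI allI impI)
    fix U :: "'k fls set" assume "openin euclidean U"
    then have U: "open U" by simp
    show "openin ?P {x \<in> topspace ?P. ?F x \<in> U}"
    proof (subst openin_subopen, intro ballI)
      fix x assume "x \<in> {x \<in> topspace ?P. ?F x \<in> U}"
      then obtain e where e: "e > 0" "\<And>y. dist y (?F x) < e \<Longrightarrow> y \<in> U"
        using U unfolding open_dist by auto
      obtain n where n: "inverse (2 ^ n) < e"
        using real_arch_pow_inv[of e "1/2"] e(1) by (auto simp: power_divide inverse_eq_divide)
      \<comment> \<open>Prescribing the coefficients up to index \<open>n\<close> is open in the
        product and confines the series to distance below \<open>inverse (2 ^ n)\<close>.\<close>
      let ?T = "PiE UNIV (\<lambda>i. if i \<le> n then {x i} else UNIV)"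
      have "openin ?P ?T"
        by (rule product_topology_basis) auto
      moreover have "?F y \<in> U" if "y \<in> ?T" for y
      proof (rule e(2))
        have "y i = x i" if "i \<le> n" for i
          using \<open>y \<in> ?T\<close> that by (auto simp: PiE_def Pi_def split: if_splits)
        then have "fls_nth (?F y - ?F x) k = 0" if "k \<le> int n" for k
          using that by (simp add: nth nat_le_iff)
        then have "dist (?F y) (?F x) < inverse (2 ^ n)"
          unfolding dist_fls_less_iff
          by (cases "?F y = ?F x") (auto intro!: fls_subdegree_greaterI)
        with n show "dist (?F y) (?F x) < e" by simp
      qed
      ultimately show "\<exists>T. openin ?P T \<and> x \<in> T \<and> T \<subseteq> {x \<in> topspace ?P. ?F x \<in> U}"
        by (intro exI[of _ ?T]) (auto simp: topspace_product_topology)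
    qed
  qed auto
  moreover have "compactin ?P UNIV"
  proof -
    have "compact_space ?P"
      by (simp add: compact_space_product_topology compact_space_discrete_topology)
    then show ?thesis by (simp add: compact_space_def topspace_product_topology PiE_UNIV_domain)
  qed
  ultimately have "compactin euclidean (?F ` UNIV)"
    using image_compactin by blast
  moreover have "?F ` UNIV = {f. fls_subdegree f \<ge> 0}"
  proof (intro equalityI subsetI)
    fix f :: "'k fls" assume "f \<in> {f. fls_subdegree f \<ge> 0}"
    then have "f = ?F (\<lambda>i. fls_nth f (int i))"
      by (auto simp: fls_eq_iff nth)
    then show "f \<in> ?F ` UNIV" by blast
  qed (auto simp: fls_subdegree_nonneg_iff)
  ultimately show ?thesis by simp
qed

text \<open>Series at distance below \<open>1\<close> share their constant term, so its nonvanishing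
  is a closed condition, and the units are the integral series that satisfy it.\<close>

lemma compact_fls_units: "compact {f :: 'k::{finite,field} fls. f \<noteq> 0 \<and> fls_subdegree f = 0}"
proof -
  have "open {f :: 'k fls. fls_nth f 0 = 0}"
    unfolding open_dist
  proof (intro ballI exI[of _ "inverse (2 ^ 0)"] conjI allI impI)
    fix f g :: "'k fls" assume "f \<in> {f. fls_nth f 0 = 0}" "dist g f < inverse (2 ^ 0)"
    then have "fls_nth (g - f) 0 = 0"
      using fls_eq0_below_subdegree[of 0 "g - f"] unfolding dist_fls_less_iff by auto
    with \<open>f \<in> _\<close> show "g \<in> {f. fls_nth f 0 = 0}" by simp
  qed simp
  then have "closed {f :: 'k fls. fls_nth f 0 \<noteq> 0}"
    by (simp add: closed_def Compl_eq)
  moreover have *: "{f :: 'k fls. f \<noteq> 0 \<and> fls_subdegree f = 0} =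
      {f. fls_subdegree f \<ge> 0} \<inter> {f. fls_nth f 0 \<noteq> 0}"
  proof -
    have "fls_nth f 0 \<noteq> 0" if "f \<noteq> 0" "fls_subdegree f = 0" for f :: "'k fls"
      using nth_fls_subdegree_nonzero[OF that(1)] that(2) by simp
    then show ?thesis
      by (auto dest: fls_subdegree_leI)
  qed
  ultimately show ?thesis
    unfolding * by (intro compact_Int_closed compact_fls_integers)
qed

subsection \<open>Diagonal affine maps\<close>

definition diag_mat :: "'a::zero ^ 'n \<Rightarrow> 'a ^ 'n ^ 'n" where
  "diag_mat d = (\<chi> i j. if i = j then d $ i else 0)"

lemma diag_mat_nth: "diag_mat d $ i $ j = (if i = j then d $ i else 0)"
  by (simp add: diag_mat_def)

lemma diag_mat_inject [simp]: "diag_mat d = diag_mat e \<longleftrightarrow> d = e"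
  by (auto simp: vec_eq_iff diag_mat_nth)

lemma diag_mat_1: "diag_mat 1 = mat 1"
  by (simp add: diag_mat_def mat_def vec_eq_iff)

lemma diag_mat_mult: "diag_mat d ** diag_mat e = diag_mat (d * e :: 'a::semiring_1 ^ 'n)"
  by (auto simp: vec_eq_iff diag_mult_nth diag_mat_nth)

lemma diag_mat_vector_mult: "diag_mat d *v w = (d * w :: 'a::semiring_1 ^ 'n)"
proof -
  have "(\<Sum>j\<in>UNIV. (if i = j then d $ i else 0) * w $ j) = (\<Sum>j\<in>UNIV. if i = j then d $ i * w $ j else 0)" for i
    by (intro sum.cong) auto
  then show ?thesis
    by (simp add: vec_eq_iff matrix_vector_mult_def diag_mat_nth)
qed

text \<open>A field contains \<open>0\<close> and \<open>1\<close>, so the base of the norm exceeds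
  one and only exponent zero gives the value one.\<close>

lemma fls_norm_eq_1_iff:
  fixes f :: "'k::{finite,field} fls"
  shows "fls_norm f = 1 \<longleftrightarrow> f \<noteq> 0 \<and> fls_subdegree f = 0"
proof -
  have "card {0, 1 :: 'k} \<le> CARD('k)"
    by (intro card_mono) auto
  then have "real CARD('k) > 1" by simp
  then have "real CARD('k) powi n = 1 \<longleftrightarrow> n = 0" for n
    using power_int_strict_increasing[of n 0 "real CARD('k)"]
      power_int_strict_increasing[of 0 n "real CARD('k)"]
    by (cases n "0::int" rule: linorder_cases) auto
  then show ?thesis by (simp add: fls_norm_def)
qed

lemma fls_subdegree_prod:
  fixes f :: "'b \<Rightarrow> 'k::field fls"
  assumes "finite A" "\<And>i. i \<in> A \<Longrightarrow> f i \<noteq> 0"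
  shows "fls_subdegree (prod f A) = (\<Sum>i\<in>A. fls_subdegree (f i))"
  using assms by (induction A rule: finite_induct) auto

lemma diag_mat_SOL_diag:
  fixes d :: "'k::{finite,field} fls ^ 'n"
  shows "diag_mat d \<in> SOL_diag \<longleftrightarrow> (\<forall>i. d $ i \<noteq> 0) \<and> (\<Sum>i\<in>UNIV. fls_subdegree (d $ i)) = 0"
proof -
  have "det (diag_mat d) = (\<Prod>i\<in>UNIV. d $ i)"
    by (subst det_diagonal) (auto simp: diag_mat_nth)
  then show ?thesis
    unfolding SOL_diag_def
    by (auto simp: diag_mat_nth invertible_det_nz fls_norm_eq_1_iff fls_subdegree_prod)
qed

lemma SOL_diagE:
  assumes "M \<in> SOL_diag"
  obtains d where "M = diag_mat d"
proof
  show "M = diag_mat (\<chi> i. M $ i $ i)"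
    using assms by (auto simp: SOL_diag_def vec_eq_iff diag_mat_nth)
qed

text \<open>Keeping only the vector of diagonal entries turns the action into the pointwise product
  of vectors.\<close>

definition affine_diag :: "'a ^ 'n \<Rightarrow> 'a::zero ^ 'n \<Rightarrow> ('a ^ 'n) \<times> ('a ^ 'n ^ 'n)" where
  "affine_diag v d = (v, diag_mat d)"

definition norm_one :: "'k::{finite,field} fls ^ 'n \<Rightarrow> bool" where
  "norm_one d \<longleftrightarrow> (\<forall>i. d $ i \<noteq> 0) \<and> (\<Sum>i\<in>UNIV. fls_subdegree (d $ i)) = 0"

lemma affine_diag_inject [simp]: "affine_diag v d = affine_diag w e \<longleftrightarrow> v = w \<and> d = e"
  by (simp add: affine_diag_def)

lemma affine_diag_carrier [simp]: "affine_diag v d \<in> carrier SOL \<longleftrightarrow> norm_one d"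
  by (simp add: affine_diag_def SOL_def norm_one_def diag_mat_SOL_diag)

lemma SOL_carrierE:
  assumes "x \<in> carrier SOL"
  obtains v d where "x = affine_diag v d" "norm_one d"
proof -
  obtain v M where x: "x = (v, M)" "M \<in> SOL_diag"
    using assms by (auto simp: SOL_def)
  obtain d where "M = diag_mat d"
    using SOL_diagE[OF x(2)] .
  then have "x = affine_diag v d"
    by (simp add: x affine_diag_def)
  with assms that show thesis by simp
qed

lemma SOL_mult [simp]:
  "affine_diag v d \<otimes>\<^bsub>SOL\<^esub> affine_diag w e = affine_diag (v + d * w) (d * e)"
  by (simp add: affine_diag_def SOL_def diag_mat_mult diag_mat_vector_mult)

lemma SOL_one: "\<one>\<^bsub>SOL\<^esub> = affine_diag 0 1"
  by (simp add: affine_diag_def SOL_def diag_mat_1)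

definition inverses :: "'a::inverse ^ 'n \<Rightarrow> 'a ^ 'n" where
  "inverses d = (\<chi> i. inverse (d $ i))"

lemma inverses_nth [simp]: "inverses d $ i = inverse (d $ i)"
  by (simp add: inverses_def)

lemma inverses_mult:
  fixes d :: "'k::{finite,field} fls ^ 'n"
  shows "norm_one d \<Longrightarrow> inverses d * d = 1" "norm_one d \<Longrightarrow> d * inverses d = 1"
  by (simp_all add: vec_eq_iff norm_one_def)

lemma norm_one_1 [simp]: "norm_one 1"
  by (simp add: norm_one_def)

lemma norm_one_inverses [simp]: "norm_one (inverses d) \<longleftrightarrow> norm_one d"
  by (simp add: norm_one_def sum_negf)

lemma inverses_1 [simp]: "inverses (1 :: 'k::field fls ^ 'n) = 1"
  by (simp add: vec_eq_iff)

lemma inverses_inverses [simp]: "inverses (inverses d) = (d :: 'k::field fls ^ 'n)"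
  by (simp add: vec_eq_iff)

lemma SOL_inv:
  fixes d :: "'k::{finite,field} fls ^ 'n"
  assumes "norm_one d"
  shows "inv\<^bsub>SOL\<^esub> affine_diag v d = affine_diag (- (inverses d * v)) (inverses d)"
  by (rule group.inv_equality[OF group_SOL]) (use assms in \<open>simp_all add: SOL_one inverses_mult\<close>)

lemma SOL_conjugate:
  fixes d :: "'k::{finite,field} fls ^ 'n"
  assumes "norm_one d"
  shows "conjugate SOL (affine_diag v 1) (affine_diag 0 d) = affine_diag (inverses d * v) 1"
  using assms by (simp add: conjugate_def SOL_inv inverses_mult)

lemma SOL_translation_nat_pow:
  "affine_diag v 1 [^]\<^bsub>SOL\<^esub> (n::nat) = affine_diag (of_nat n * v) 1"
  by (induction n) (simp_all add: SOL_one algebra_simps)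

lemma SOL_translation_int_pow:
  fixes v :: "'k::{finite,field} fls ^ 'n"
  shows "affine_diag v 1 [^]\<^bsub>SOL\<^esub> (n::int) = affine_diag (of_int n * v) 1"
  by (cases n rule: int_cases2)
    (simp_all add: int_pow_int group.int_pow_neg_int[OF group_SOL] SOL_translation_nat_pow SOL_inv)

lemma SOL_diagonal_nat_pow:
  "affine_diag 0 d [^]\<^bsub>SOL\<^esub> (n::nat) = affine_diag 0 (\<chi> i. d $ i ^ n)"
  by (induction n) (simp_all add: SOL_one vec_eq_iff mult.commute)

lemma SOL_diagonal_int_pow:
  fixes d :: "'k::{finite,field} fls ^ 'n"
  assumes "norm_one d"
  shows "affine_diag 0 d [^]\<^bsub>SOL\<^esub> (n::int) = affine_diag 0 (\<chi> i. d $ i powi n)"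
proof (cases n rule: int_cases2)
  case (nonneg m)
  then show ?thesis by (simp add: int_pow_int SOL_diagonal_nat_pow)
next
  case (nonpos m)
  have "norm_one (\<chi> i. d $ i ^ m)"
    using assms by (simp add: norm_one_def fls_subdegree_pow flip: sum_distrib_left)
  then show ?thesis
    using nonpos assms
    by (simp add: group.int_pow_neg_int[OF group_SOL] SOL_diagonal_nat_pow SOL_inv)
      (simp add: vec_eq_iff power_int_minus)
qed

subsection \<open>The lattice\<close>

lemma norm_one_places [simp]:
  "norm_one (place_t :: 'k::{finite,field} fls ^ 3)" "norm_one (place_t1 :: 'k fls ^ 3)"
  by (simp_all add: norm_one_def sum_3 subdegree_place_t subdegree_place_t1)

definition lattice_a :: "('k::{finite,field} fls ^ 3) \<times> ('k fls ^ 3 ^ 3)" where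
  "lattice_a = affine_diag 1 1"

text \<open>Conjugation \<open>g^-1 x g\<close> by a diagonal \<open>d\<close> multiplies
  translations by \<open>inverses d\<close>; the inverses here make \<open>s\<close> and
  \<open>t\<close> act as multiplication by \<open>t + 1\<close> and \<open>t\<close>.\<close>

definition lattice_s :: "('k::{finite,field} fls ^ 3) \<times> ('k fls ^ 3 ^ 3)" where
  "lattice_s = affine_diag 0 (inverses place_t1)"

definition lattice_t :: "('k::{finite,field} fls ^ 3) \<times> ('k fls ^ 3 ^ 3)" where
  "lattice_t = affine_diag 0 (inverses place_t)"

lemmas lattice_gens_def = lattice_a_def lattice_s_def lattice_t_def

lemma lattice_gens_carrier [simp]:
  "lattice_a \<in> carrier SOL" "lattice_s \<in> carrier SOL" "lattice_t \<in> carrier SOL"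
  by (simp_all add: lattice_gens_def)

lemma fls_const_mod_ring:
  "of_int (to_int_mod_ring c) = (fls_const c :: 'p::prime_card mod_ring fls)"
proof -
  have "fls_const (of_int n) = (of_int n :: 'p mod_ring fls)" for n
    by (simp add: fls_of_int)
  from this[of "to_int_mod_ring c"] show ?thesis
    by (simp add: of_int_of_int_mod_ring)
qed

lemma of_int_index: "(of_int n :: 'a::ring_1 ^ 'n) $ i = of_int n"
  by (cases n rule: int_cases2) (simp_all add: of_nat_index)

text \<open>The power relation is characteristic \<open>p\<close>, the commutators vanish because
  diagonals commute and so do translations, and the last relation is
  \<open>place_t1_eq\<close>.\<close>

interpretation lattice: Lambda_relations "SOL :: (('p mod_ring fls ^ 3) \<times> _) monoid"
  lattice_a lattice_s lattice_t "TYPE('p::prime_card)"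
proof -
  interpret group "SOL :: (('p mod_ring fls ^ 3) \<times> ('p mod_ring fls ^ 3 ^ 3)) monoid"
    by (rule group_SOL)
  have "(of_nat CARD('p) :: 'p mod_ring fls) = 0"
    by (simp add: fls_of_nat)
  then have "(of_nat CARD('p) :: 'p mod_ring fls ^ 3) = 0"
    by (simp add: vec_eq_iff of_nat_index)
  then have pow: "lattice_a [^]\<^bsub>SOL\<^esub> CARD('p) =
      (\<one>\<^bsub>SOL\<^esub> :: ('p mod_ring fls ^ 3) \<times> ('p mod_ring fls ^ 3 ^ 3))"
    by (simp add: lattice_a_def SOL_translation_nat_pow SOL_one)
  have conj_t: "conjugate SOL lattice_a lattice_t =
      (affine_diag place_t 1 :: ('p mod_ring fls ^ 3) \<times> ('p mod_ring fls ^ 3 ^ 3))"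
    and conj_s: "conjugate SOL lattice_a lattice_s =
      (affine_diag place_t1 1 :: ('p mod_ring fls ^ 3) \<times> ('p mod_ring fls ^ 3 ^ 3))"
    by (simp_all add: lattice_gens_def SOL_conjugate)
  show "Lambda_relations TYPE('p) (SOL :: (('p mod_ring fls ^ 3) \<times> _) monoid) lattice_a lattice_s lattice_t"
  proof unfold_locales
    show "commutator SOL lattice_s lattice_t =
        (\<one>\<^bsub>SOL\<^esub> :: ('p mod_ring fls ^ 3) \<times> ('p mod_ring fls ^ 3 ^ 3))"
      by (subst commutator_eq_one_iff) (simp_all add: lattice_gens_def mult.commute)
    show "commutator SOL (conjugate SOL lattice_a lattice_t) lattice_a =
        (\<one>\<^bsub>SOL\<^esub> :: ('p mod_ring fls ^ 3) \<times> ('p mod_ring fls ^ 3 ^ 3))"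
      unfolding conj_t by (subst commutator_eq_one_iff) (simp_all add: lattice_a_def add.commute)
    show "conjugate SOL lattice_a lattice_s \<otimes>\<^bsub>SOL\<^esub>
        inv\<^bsub>SOL\<^esub> (conjugate SOL lattice_a lattice_t \<otimes>\<^bsub>SOL\<^esub> lattice_a) =
        (\<one>\<^bsub>SOL\<^esub> :: ('p mod_ring fls ^ 3) \<times> ('p mod_ring fls ^ 3 ^ 3))"
      unfolding conj_t conj_s by (simp add: lattice_a_def SOL_inv SOL_one place_t1_eq)
  qed (simp_all add: pow)
qed

section \<open>Normal forms inside \<open>SOL5\<close>\<close>

lemma lattice_lamp:
  "lattice.lamp (f :: 'p::prime_card mod_ring poly) = affine_diag (\<chi> c. peval f (place_t $ c)) 1"
proof (induction f)
  case 0
  then show ?case by (simp add: SOL_one zero_vec_def)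
next
  case (pCons c f)
  then show ?case
    by (simp add: lattice.lamp_pCons, simp add: lattice_gens_def SOL_conjugate SOL_translation_int_pow)
      (simp add: vec_eq_iff of_int_index fls_const_mod_ring)
qed

text \<open>The translation part is a fraction with denominator \<open>(t + 1)^k t^i\<close>, thus a
  general element of \<open>F_p[t, 1/t, 1/(t+1)]\<close>; in the diagonal part only the total
  exponents survive.\<close>

lemma lattice_nf_val:
  "lattice.nf_val (k, i, f :: 'p::prime_card mod_ring poly, l, j) =
    affine_diag (\<chi> c. peval f (place_t $ c) / (place_t1 $ c ^ k * place_t $ c ^ i))
      (\<chi> c. place_t1 $ c powi (- (int k + l)) * place_t $ c powi (- (int i + j)))"
proof -
  have "inverse y ^ k * inverse x ^ i * inverse y powi l * inverse x powi j =
      y powi (- (int k + l)) * x powi (- (int i + j))" if "x \<noteq> 0" "y \<noteq> 0" for x y :: "'p mod_ring fls"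
    using that by (simp add: power_int_minus power_int_add power_int_inverse power_inverse
        del: minus_add_distrib)
  then show ?thesis
    by (simp add: lattice_lamp, simp add: lattice_gens_def SOL_diagonal_int_pow SOL_diagonal_nat_pow)
      (simp add: vec_eq_iff divide_inverse power_inverse mult_ac)
qed

text \<open>At the first place \<open>t\<close> is a uniformiser and \<open>t + 1\<close> a unit, at
  the second the reverse, so two valuations recover both total exponents.\<close>

lemma lattice_nf_val_subdegree:
  fixes k i l j
  defines "d \<equiv> (\<chi> c. place_t1 $ c powi (- (int k + l)) * place_t $ c powi (- (int i + j)))
    :: 'k::field fls ^ 3"
  shows "fls_subdegree (d $ 1) = - (int i + j)" "fls_subdegree (d $ 2) = - (int k + l)" "d $ c \<noteq> 0"
  by (simp_all add: d_def subdegree_place_t subdegree_place_t1 power_int_eq_0_iff)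

text \<open>The denominator has total valuation zero, so the product formula passes from the
  numerator to the fraction; positive valuations at all three places would contradict it.\<close>

lemma lattice_translation_nonzero:
  fixes f :: "'k::field poly" and k i :: nat
  assumes "f \<noteq> 0"
  defines "v \<equiv> \<lambda>c. peval f (place_t $ c) / (place_t1 $ c ^ k * place_t $ c ^ i)"
  shows "\<exists>c. v c \<noteq> 0 \<and> fls_subdegree (v c) \<le> 0"
proof -
  have nz: "v c \<noteq> 0" for c
    using place_product_formula[OF assms(1)] by (simp add: v_def)
  have "fls_subdegree (v c) = fls_subdegree (peval f (place_t $ c)) -
      (int k * fls_subdegree (place_t1 $ c :: 'k fls) + int i * fls_subdegree (place_t $ c :: 'k fls))" for c
    using place_product_formula[OF assms(1)]
    by (simp add: v_def divide_inverse fls_subdegree_pow)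
  then have "(\<Sum>c\<in>UNIV. fls_subdegree (v c)) = (\<Sum>c\<in>UNIV. fls_subdegree (peval f (place_t $ c)))"
    by (simp add: sum_3 subdegree_place_t subdegree_place_t1)
  also have "\<dots> \<le> 0"
    using place_product_formula[OF assms(1)] by simp
  finally have "\<exists>c. fls_subdegree (v c) \<le> 0"
    by (metis (no_types, lifting) not_le sum_pos finite_class.finite_UNIV UNIV_not_empty)
  with nz show ?thesis by blast
qed

text \<open>The diagonal part fixes the total exponents and the translation part forces
  \<open>f = 0\<close>. The exponents need not vanish singly, as normal forms are not
  unique.\<close>

lemma lattice_nf_val_eq_one:
  assumes "lattice.nf_val (k, i, f :: 'p::prime_card mod_ring poly, l, j) = \<one>\<^bsub>SOL\<^esub>"
  shows "f = 0" "l = - int k" "j = - int i"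
proof -
  let ?d = "(\<chi> c. place_t1 $ c powi (- (int k + l)) * place_t $ c powi (- (int i + j)))
    :: 'p mod_ring fls ^ 3"
  have v: "(\<chi> c. peval f (place_t $ c) / (place_t1 $ c ^ k * place_t $ c ^ i)) = 0" and "?d = 1"
    using assms unfolding lattice_nf_val SOL_one by (auto simp only: affine_diag_inject)
  then have "fls_subdegree (?d $ c) = 0" for c
    by simp
  from this[of 1] this[of 2] show "l = - int k" "j = - int i"
    unfolding lattice_nf_val_subdegree by simp_all
  show "f = 0"
    using lattice_translation_nonzero[of f k i] v by (auto simp: vec_eq_iff)
qed

text \<open>The arithmetic core of discreteness. Equal valuations force equal exponents, hence equal
  diagonals; a difference of translations that is small at all places vanishes by
  \<open>lattice_translation_nonzero\<close>.\<close>

lemma lattice_separated: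
  fixes f f' :: "'p::prime_card mod_ring poly"
  assumes x: "lattice.nf_val (k, i, f, l, j) = affine_diag v d"
    and y: "lattice.nf_val (k', i', f', l', j') = affine_diag w e"
    and near: "\<And>c. w $ c = v $ c \<or> fls_subdegree (w $ c - v $ c) > 0"
    and deg: "\<And>c. fls_subdegree (e $ c) = fls_subdegree (d $ c)"
  shows "w = v \<and> e = d"
proof
  have v: "v $ c = peval f (place_t $ c) / (place_t1 $ c ^ k * place_t $ c ^ i)"
    and w: "w $ c = peval f' (place_t $ c) / (place_t1 $ c ^ k' * place_t $ c ^ i')" for c
    using x y unfolding lattice_nf_val affine_diag_inject by auto
  have d: "d = (\<chi> c. place_t1 $ c powi (- (int k + l)) * place_t $ c powi (- (int i + j)))"
    and e: "e = (\<chi> c. place_t1 $ c powi (- (int k' + l')) * place_t $ c powi (- (int i' + j')))"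
    using x y unfolding lattice_nf_val affine_diag_inject by auto
  have "- (int i' + j') = - (int i + j)" "- (int k' + l') = - (int k + l)"
    using deg[of 1] deg[of 2] unfolding d e lattice_nf_val_subdegree by blast+
  then show "e = d"
    unfolding d e by (simp only:)
  \<comment> \<open>The numerator of \<open>w - v\<close> over the common denominator
    \<open>(t + 1)^(k + k') t^(i + i')\<close>.\<close>
  define g where "g = [:1, 1:] ^ k * [:0, 1:] ^ i * f' - [:1, 1:] ^ k' * [:0, 1:] ^ i' * f"
  have lin: "peval [:1, 1:] (place_t $ c) = (place_t1 $ c :: 'p mod_ring fls)"
    "peval [:0, 1:] (place_t $ c) = (place_t $ c :: 'p mod_ring fls)" for c
    by (simp_all add: place_t1_nth)
  have peval_g: "peval g (place_t $ c) = place_t1 $ c ^ k * place_t $ c ^ i * peval f' (place_t $ c)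
      - place_t1 $ c ^ k' * place_t $ c ^ i' * peval f (place_t $ c)" for c
    unfolding g_def diff_conv_add_uminus[of "_ * f'"] peval_add peval_uminus peval_mult peval_power lin by simp
  have wv: "w $ c - v $ c = peval g (place_t $ c) / (place_t1 $ c ^ (k + k') * place_t $ c ^ (i + i'))" for c
    unfolding v w peval_g by (simp add: diff_frac_eq power_add mult_ac)
  have "g = 0"
  proof (rule ccontr)
    assume "g \<noteq> 0"
    from lattice_translation_nonzero[OF this, of "k + k'" "i + i'"]
    obtain c where "w $ c - v $ c \<noteq> 0" "fls_subdegree (w $ c - v $ c) \<le> 0"
      unfolding wv by blast
    with near[of c] show False by auto
  qed
  then show "w = v"
    using wv by (simp add: vec_eq_iff)
qed

section \<open>The homomorphism into \<open>SOL5\<close> and its kernel\<close>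

definition lattice_hom :: "gen word set \<Rightarrow> ('p::prime_card mod_ring fls ^ 3) \<times> ('p mod_ring fls ^ 3 ^ 3)" where
  "lattice_hom = free_lift SOL (case_gen lattice_a lattice_s lattice_t)"

definition Lambda_lattice :: "(('p::prime_card mod_ring fls ^ 3) \<times> ('p mod_ring fls ^ 3 ^ 3)) set" where
  "Lambda_lattice = lattice_hom ` carrier free_group"

lemma case_gen_closed: "case_gen lattice_a lattice_s lattice_t x \<in> carrier SOL"
  by (cases x) auto

lemma lattice_hom_hom: "lattice_hom \<in> hom free_group SOL"
  unfolding lattice_hom_def by (rule group.free_lift_hom[OF group_SOL case_gen_closed])

lemma lattice_hom_group_hom: "group_hom free_group SOL lattice_hom"
  by (simp add: group_hom_def group_hom_axioms_def group_free_group group_SOL lattice_hom_hom)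

lemma lattice_hom_gen: "lattice_hom (free_gen x) = case_gen lattice_a lattice_s lattice_t x"
  unfolding lattice_hom_def by (rule group.free_lift_gen[OF group_SOL case_gen_closed])

lemma lattice_hom_class: "lattice_hom (free_class w) = lattice.nf_val (nf w)"
  unfolding lattice_hom_def group.free_lift_class[OF group_SOL case_gen_closed]
  by (rule lattice.word_val_nf)

lemma subgroup_lattice:
  "subgroup (Lambda_lattice :: (('p::prime_card mod_ring fls ^ 3) \<times> _) set) SOL"
  unfolding Lambda_lattice_def by (rule group_hom.img_is_subgroup[OF lattice_hom_group_hom])

lemma lattice_gens:
  "lattice_a \<in> (Lambda_lattice :: (('p::prime_card mod_ring fls ^ 3) \<times> _) set)"
  "lattice_s \<in> (Lambda_lattice :: (('p mod_ring fls ^ 3) \<times> _) set)"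
  "lattice_t \<in> (Lambda_lattice :: (('p mod_ring fls ^ 3) \<times> _) set)"
proof -
  have "case_gen lattice_a lattice_s lattice_t x \<in> (Lambda_lattice :: (('p mod_ring fls ^ 3) \<times> _) set)" for x
    unfolding Lambda_lattice_def lattice_hom_gen[symmetric]
    by (simp add: free_gen_def free_group_carrier)
  from this[of Gen_a] this[of Gen_s] this[of Gen_t]
  show "lattice_a \<in> (Lambda_lattice :: (('p mod_ring fls ^ 3) \<times> _) set)"
    "lattice_s \<in> (Lambda_lattice :: (('p mod_ring fls ^ 3) \<times> _) set)"
    "lattice_t \<in> (Lambda_lattice :: (('p mod_ring fls ^ 3) \<times> _) set)" by simp_all
qed

text \<open>The relators die in \<open>SOL\<close>, which gives one inclusion. Conversely,
  \<open>nf w\<close> depends only on the word, not on the group: being trivial in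
  \<open>SOL\<close> constrains it enough to be trivial in \<open>Lambda\<close> too.\<close>

lemma kernel_lattice_hom:
  "kernel free_group SOL (lattice_hom :: _ \<Rightarrow> ('p::prime_card mod_ring fls ^ 3) \<times> _) =
     normal_closure free_group (Lambda_relators CARD('p))"
  (is "kernel _ _ ?h = ?N")
proof (intro equalityI subsetI)
  interpret h: group_hom free_group SOL ?h by (rule lattice_hom_group_hom)
  have "?h ` Lambda_relators CARD('p) = {\<one>\<^bsub>SOL\<^esub>}"
    by (subst hom_image_Lambda_relators[OF group_SOL lattice_hom_hom])
      (simp add: lattice_hom_gen lattice.a_pow_p lattice.s_t lattice.a_t_a lattice.a_s)
  then have "Lambda_relators CARD('p) \<subseteq> kernel free_group SOL ?h"
    using Lambda_relators_carrier by (auto simp: kernel_def)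
  then show "x \<in> kernel free_group SOL ?h" if "x \<in> ?N" for x
    using that h.normal_kernel unfolding normal_closure_def by blast
next
  interpret N: normal ?N free_group
    by (rule normal_normal_closure[OF group_free_group Lambda_relators_carrier])
  let ?\<pi> = "\<lambda>x. ?N #>\<^bsub>free_group\<^esub> x"
  have Lambda: "Lambda CARD('p) = free_group Mod ?N"
    by (simp add: Lambda_def presented_group_def)
  then have hom: "?\<pi> \<in> hom free_group (Lambda CARD('p))"
    using N.r_coset_hom_Mod by simp
  have one: "\<one>\<^bsub>Lambda CARD('p)\<^esub> = ?N"
    by (simp add: Lambda FactGroup_def)
  have "?\<pi> r = \<one>\<^bsub>Lambda CARD('p)\<^esub>" if "r \<in> Lambda_relators CARD('p)" for r
    unfolding one using that by (intro N.rcos_const) (auto simp: normal_closure_def)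
  then have rel: "\<And>y. y \<in> ?\<pi> ` Lambda_relators CARD('p) \<Longrightarrow> y = \<one>\<^bsub>Lambda CARD('p)\<^esub>"
    by blast
  note rel = rel[unfolded hom_image_Lambda_relators[OF group_Lambda hom]]
  have closed: "?\<pi> (free_gen x) \<in> carrier (Lambda CARD('p))" for x
    using hom by (auto simp: hom_def free_gen_def free_group_carrier)
  \<comment> \<open>The presented group satisfies its own relations, so normal forms may be
    evaluated there.\<close>
  interpret Q: Lambda_relations "Lambda CARD('p)" "?\<pi> (free_gen Gen_a)" "?\<pi> (free_gen Gen_s)"
    "?\<pi> (free_gen Gen_t)" "TYPE('p)"
    by (intro Lambda_relations.intro Lambda_relations_axioms.intro group_Lambda closed rel) simp_all
  fix x assume x: "x \<in> kernel free_group SOL ?h"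
  then obtain w where w: "x = free_class w"
    by (auto simp: kernel_def free_group_carrier)
  obtain k i f l j where nf: "nf w = (k, i, f :: 'p mod_ring poly, l, j)"
    by (cases "nf w :: 'p normal_form") auto
  have "lattice.nf_val (k, i, f, l, j) = \<one>\<^bsub>SOL\<^esub>"
    using x by (simp only: kernel_def w lattice_hom_class nf mem_Collect_eq)
  note nf_one = lattice_nf_val_eq_one[OF this]
  have gens: "(\<lambda>x. ?\<pi> (free_gen x)) =
      case_gen (?\<pi> (free_gen Gen_a)) (?\<pi> (free_gen Gen_s)) (?\<pi> (free_gen Gen_t))"
    by (rule ext) (auto split: gen.split)
  have "?\<pi> x = Q.nf_val (nf w)"
    unfolding w group.hom_free_class[OF group_Lambda hom] gens by (rule Q.word_val_nf)
  also have "\<dots> = \<one>\<^bsub>Lambda CARD('p)\<^esub>"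
  proof -
    \<comment> \<open>With \<open>f = 0\<close>, \<open>l = - k\<close> and \<open>j = - i\<close>
      the normal form is \<open>s^k t^i s^-k t^-i\<close>, trivial because \<open>s\<close> and
      \<open>t\<close> commute.\<close>
    have "s [^]\<^bsub>Lambda CARD('p)\<^esub> k \<otimes>\<^bsub>Lambda CARD('p)\<^esub> t [^]\<^bsub>Lambda CARD('p)\<^esub> i \<otimes>\<^bsub>Lambda CARD('p)\<^esub>
        inv\<^bsub>Lambda CARD('p)\<^esub> (s [^]\<^bsub>Lambda CARD('p)\<^esub> k) \<otimes>\<^bsub>Lambda CARD('p)\<^esub>
        inv\<^bsub>Lambda CARD('p)\<^esub> (t [^]\<^bsub>Lambda CARD('p)\<^esub> i) = \<one>\<^bsub>Lambda CARD('p)\<^esub>"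
      if "s \<in> carrier (Lambda CARD('p))" "t \<in> carrier (Lambda CARD('p))"
        "s \<otimes>\<^bsub>Lambda CARD('p)\<^esub> t = t \<otimes>\<^bsub>Lambda CARD('p)\<^esub> s" for s t
    proof -
      have "s [^]\<^bsub>Lambda CARD('p)\<^esub> int k \<otimes>\<^bsub>Lambda CARD('p)\<^esub> t [^]\<^bsub>Lambda CARD('p)\<^esub> int i
          = t [^]\<^bsub>Lambda CARD('p)\<^esub> int i \<otimes>\<^bsub>Lambda CARD('p)\<^esub> s [^]\<^bsub>Lambda CARD('p)\<^esub> int k"
        using that by (intro Q.commute_int_pow Q.commute_int_pow[symmetric]) auto
      then show ?thesis
        using that by (simp add: int_pow_int Q.m_assoc flip: Q.inv_mult_group)
    qed
    from this[OF Q.gens_closed(2,3) Q.s_t_commute] show ?thesis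
      by (simp add: nf nf_one Q.int_pow_neg_int)
  qed
  finally have "?\<pi> x = ?N"
    by (simp add: one)
  then show "x \<in> ?N"
    using N.rcos_self[of x] N.is_subgroup x by (auto simp: kernel_def)
qed

text \<open>First isomorphism theorem, with the codomain cut down to the image so that the map is
  onto.\<close>

lemma Lambda_iso_lattice:
  "Lambda CARD('p::prime_card) \<cong> SOL\<lparr>carrier := Lambda_lattice :: (('p mod_ring fls ^ 3) \<times> _) set\<rparr>"
proof -
  let ?S = "SOL\<lparr>carrier := Lambda_lattice :: (('p mod_ring fls ^ 3) \<times> ('p mod_ring fls ^ 3 ^ 3)) set\<rparr>"
  have "group ?S"
    using group.subgroup_imp_group[OF group_SOL subgroup_lattice] .
  moreover have "lattice_hom \<in> hom free_group ?S"
    using lattice_hom_hom by (auto simp: hom_def Lambda_lattice_def)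
  ultimately interpret group_hom free_group ?S lattice_hom
    by (simp add: group_hom_def group_hom_axioms_def group_free_group)
  have "kernel free_group ?S lattice_hom = normal_closure free_group (Lambda_relators CARD('p))"
    using kernel_lattice_hom[where 'p = 'p] by (simp add: kernel_def)
  moreover have "lattice_hom ` carrier free_group = carrier ?S"
    by (simp add: Lambda_lattice_def)
  ultimately show ?thesis
    using FactGroup_iso by (simp add: Lambda_def presented_group_def)
qed

section \<open>Discreteness\<close>

lemma discrete_lattice:
  "subtopology SOL_topology Lambda_lattice =
     discrete_topology (Lambda_lattice :: (('p::prime_card mod_ring fls ^ 3) \<times> _) set)"
proof -
  let ?L = "Lambda_lattice :: (('p mod_ring fls ^ 3) \<times> ('p mod_ring fls ^ 3 ^ 3)) set"
  have sub: "?L \<subseteq> carrier SOL"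
    by (rule subgroup.subset[OF subgroup_lattice])
  then have top: "subtopology SOL_topology ?L = top_of_set ?L"
    by (simp add: SOL_topology_def subtopology_subtopology Int_absorb1)
  have nfE: "\<exists>k i f l j. x = lattice.nf_val (k, i, f :: 'p mod_ring poly, l, j)" if x: "x \<in> ?L" for x
  proof -
    obtain w where w: "x = lattice.nf_val (nf w)"
      using x by (auto simp: Lambda_lattice_def free_group_carrier lattice_hom_class)
    obtain k i f l j where "nf w = (k, i, f :: 'p mod_ring poly, l, j)"
      by (cases "nf w :: 'p normal_form") auto
    with w show ?thesis by metis
  qed
  have "openin (top_of_set ?L) {x}" if x: "x \<in> ?L" for x
  proof -
    obtain v d where xvd: "x = affine_diag v d" and d: "norm_one d"
      using subsetD[OF sub x] by (rule SOL_carrierE)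
    \<comment> \<open>Radius \<open>1\<close> on translations leaves a difference that is zero or of
      positive valuation. The radius on the diagonal forces equal valuations; for a negative
      subdegree \<open>nat\<close> gives \<open>0\<close>, and radius \<open>1\<close> is still
      small enough.\<close>
    let ?T = "\<lambda>c. {y :: ('p mod_ring fls ^ 3) \<times> ('p mod_ring fls ^ 3 ^ 3).
        dist (fst y $ c) (v $ c) < inverse (2 ^ 0) \<and>
        dist (snd y $ c $ c) (d $ c) < inverse (2 ^ nat (fls_subdegree (d $ c)))}"
    have "open (?T c)" for c
      by (intro open_Collect_conj open_Collect_less continuous_intros)
    then have "open (\<Inter>c. ?T c)"
      by (intro open_INT) auto
    moreover have "?L \<inter> (\<Inter>c. ?T c) = {x}"
    proof (intro equalityI subsetI)
      fix y assume y: "y \<in> ?L \<inter> (\<Inter>c. ?T c)"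
      then have "y \<in> carrier SOL"
        using subsetD[OF sub] by simp
      then obtain w e where ywe: "y = affine_diag w e"
        by (rule SOL_carrierE)
      have near: "dist (w $ c) (v $ c) < inverse (2 ^ 0)"
        "dist (e $ c) (d $ c) < inverse (2 ^ nat (fls_subdegree (d $ c)))" for c
        using y by (auto simp: ywe affine_diag_def diag_mat_nth)
      have deg: "fls_subdegree (e $ c) = fls_subdegree (d $ c)" for c
      proof (cases "e $ c = d $ c")
        case False
        then have "fls_subdegree (e $ c - d $ c) > fls_subdegree (d $ c)"
          using near(2)[of c] unfolding dist_fls_less_iff
          by (auto split: if_splits)
        then have "fls_subdegree (d $ c + (e $ c - d $ c)) = fls_subdegree (d $ c)"
          using d by (intro fls_subdegree_add_eq1) (auto simp: norm_one_def)
        then show ?thesis by simp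
      qed simp
      have small: "w $ c = v $ c \<or> fls_subdegree (w $ c - v $ c) > 0" for c
        using near(1)[of c] unfolding dist_fls_less_iff by simp
      from nfE[OF x] obtain k i f l j where nf_x: "x = lattice.nf_val (k, i, f :: 'p mod_ring poly, l, j)"
        by (elim exE)
      from nfE[OF IntD1[OF y]] obtain k' i' f' l' j'
        where nf_y: "y = lattice.nf_val (k', i', f' :: 'p mod_ring poly, l', j')"
        by (elim exE)
      have "w = v \<and> e = d"
        by (rule lattice_separated[OF trans[OF nf_x[symmetric] xvd] trans[OF nf_y[symmetric] ywe]
              small deg])
      then show "y \<in> {x}" by (simp add: xvd ywe)
    qed (use x in \<open>auto simp: xvd affine_diag_def diag_mat_nth\<close>)
    ultimately show ?thesis
      unfolding openin_open by (intro exI[of _ "\<Inter>c. ?T c"]) simp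
  qed
  then show ?thesis
    unfolding top by (intro discrete_topology_unique[THEN iffD2, symmetric]) simp
qed

section \<open>Cocompactness\<close>

text \<open>Horner's rule: alternately multiplying by \<open>z\<close> and adding a multiple of the
  translation \<open>lattice_a\<close> never leaves the lattice.\<close>

lemma lattice_peval:
  fixes z :: "'p::prime_card mod_ring fls ^ 3"
  assumes "\<And>v. affine_diag v 1 \<in> Lambda_lattice \<Longrightarrow> affine_diag (z * v) 1 \<in> Lambda_lattice"
  shows "affine_diag (\<chi> c. peval f (z $ c)) 1 \<in> Lambda_lattice"
proof (induction f)
  case 0
  then show ?case
    using subgroup.one_closed[OF subgroup_lattice[where 'p = 'p]] by (simp add: SOL_one zero_vec_def)
next
  case (pCons b f)
  have "lattice_a [^]\<^bsub>SOL\<^esub> to_int_mod_ring b \<in> (Lambda_lattice :: (('p mod_ring fls ^ 3) \<times> _) set)"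
    by (rule group.subgroup_int_pow_closed[OF group_SOL subgroup_lattice lattice_gens(1)])
  from subgroup.m_closed[OF subgroup_lattice this assms[OF pCons.IH]]
  have "affine_diag (of_int (to_int_mod_ring b) + z * (\<chi> c. peval f (z $ c))) 1 \<in> Lambda_lattice"
    by (simp add: lattice_a_def SOL_translation_int_pow)
  moreover have "of_int (to_int_mod_ring b) + z * (\<chi> c. peval f (z $ c)) =
      (\<chi> c. peval (pCons b f) (z $ c))"
    by (simp add: vec_eq_iff of_int_index fls_const_mod_ring)
  ultimately show ?case by simp
qed

lemma lattice_translations:
  fixes f g h :: "'p::prime_card mod_ring poly"
  shows "affine_diag (\<chi> c. peval f (inverse (place_t $ c)) + peval g (inverse (place_t1 $ c)) +
    peval h (place_t $ c)) 1 \<in> Lambda_lattice"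
proof -
  have conj: "affine_diag (inverses d * v) 1 \<in> Lambda_lattice"
    if "affine_diag v 1 \<in> Lambda_lattice" "affine_diag 0 d \<in> Lambda_lattice" for v d :: "'p mod_ring fls ^ 3"
  proof -
    have "norm_one d"
      using subgroup.mem_carrier[OF subgroup_lattice that(2)] by simp
    then have "affine_diag (inverses d * v) 1 = conjugate SOL (affine_diag v 1) (affine_diag 0 d)"
      by (simp add: SOL_conjugate)
    also have "\<dots> \<in> Lambda_lattice"
      unfolding conjugate_def
      by (intro subgroup.m_closed[OF subgroup_lattice] subgroup.m_inv_closed[OF subgroup_lattice] that)
    finally show ?thesis .
  qed
  have diag: "affine_diag 0 (inverses place_t) \<in> (Lambda_lattice :: (('p mod_ring fls ^ 3) \<times> _) set)"
    "affine_diag 0 (inverses place_t1) \<in> (Lambda_lattice :: (('p mod_ring fls ^ 3) \<times> _) set)"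
    using lattice_gens[where 'p = 'p] by (simp_all add: lattice_gens_def)
  have inv_diag: "affine_diag 0 place_t \<in> (Lambda_lattice :: (('p mod_ring fls ^ 3) \<times> _) set)"
    "affine_diag 0 place_t1 \<in> (Lambda_lattice :: (('p mod_ring fls ^ 3) \<times> _) set)"
    using diag[THEN subgroup.m_inv_closed[OF subgroup_lattice]] by (simp_all add: SOL_inv)
  \<comment> \<open>Since \<open>conj\<close> inverts the diagonal, multiplication by
    \<open>place_t\<close> comes from \<open>lattice_t\<close> itself, and multiplication by the
    inverses from the inverse elements.\<close>
  have "affine_diag (\<chi> c. peval f (inverses place_t $ c)) 1 \<in> Lambda_lattice"
    "affine_diag (\<chi> c. peval g (inverses place_t1 $ c)) 1 \<in> Lambda_lattice"
    "affine_diag (\<chi> c. peval h (place_t $ c)) 1 \<in> Lambda_lattice"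
    using conj[OF _ diag(1)] conj[OF _ inv_diag(1)] conj[OF _ inv_diag(2)]
    by (intro lattice_peval; simp)+
  from subgroup.m_closed[OF subgroup_lattice subgroup.m_closed[OF subgroup_lattice this(1,2)] this(3)]
  show ?thesis
    by (simp add: plus_vec_def)
qed

text \<open>The continuous projection maps \<open>K\<close> onto the coset space, since every coset
  meets \<open>K\<close>.\<close>

lemma compact_coset_space:
  assumes "group G" "subgroup H G" and top: "topspace T = carrier G" and K: "compactin T K"
    and cover: "\<And>x. x \<in> carrier G \<Longrightarrow> \<exists>k\<in>K. \<exists>h\<in>H. x = k \<otimes>\<^bsub>G\<^esub> h"
  shows "compact_space (coset_space T G H)"
proof -
  interpret group G by fact
  let ?q = "\<lambda>x. x <#\<^bsub>G\<^esub> H"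
  note openin = openin_coset_space[OF assms(1,2)]
  have self: "x \<in> ?q x" if "x \<in> carrier G" for x
    using lcos_self[OF that assms(2)] .
  have Union: "\<Union>(lcosets\<^bsub>G\<^esub> H) = carrier G"
    by (rule lcosets_part_G[OF assms(2)])
  have "openin (coset_space T G H) (lcosets\<^bsub>G\<^esub> H)"
    using openin_topspace[of T] by (simp add: openin Union flip: top)
  then have topspace: "topspace (coset_space T G H) = lcosets\<^bsub>G\<^esub> H"
    unfolding topspace_def using openin by blast
  have "continuous_map T (coset_space T G H) ?q"
    unfolding continuous_map_def
  proof (intro conjI allI impI)
    show "?q \<in> topspace T \<rightarrow> topspace (coset_space T G H)"
      by (auto simp: topspace top LCOSETS_def)
    fix U assume U: "openin (coset_space T G H) U"
    \<comment> \<open>The cosets partition the group, so a coset belongs to \<open>U\<close> exactly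
      when its points lie in the union of \<open>U\<close>.\<close>
    have "{x \<in> topspace T. ?q x \<in> U} = \<Union>U"
    proof (intro equalityI subsetI)
      fix x assume "x \<in> {x \<in> topspace T. ?q x \<in> U}"
      then show "x \<in> \<Union>U" using self top by auto
    next
      fix x assume "x \<in> \<Union>U"
      then obtain A where A: "A \<in> U" "x \<in> A" by blast
      then obtain y where y: "y \<in> carrier G" "A = ?q y"
        using U unfolding openin LCOSETS_def by blast
      then have "?q y = ?q x"
        using l_repr_independence[OF _ _ assms(2)] A by blast
      moreover have "x \<in> carrier G"
        using A U Union unfolding openin by blast
      ultimately show "x \<in> {x \<in> topspace T. ?q x \<in> U}"
        using A y top by auto
    qed
    then show "openin T {x \<in> topspace T. ?q x \<in> U}"
      using U unfolding openin by simp
  qed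
  then have "compactin (coset_space T G H) (?q ` K)"
    using K image_compactin by blast
  moreover have "lcosets\<^bsub>G\<^esub> H \<subseteq> ?q ` K"
  proof
    fix A assume "A \<in> lcosets\<^bsub>G\<^esub> H"
    then obtain x where x: "x \<in> carrier G" "A = ?q x"
      by (auto simp: LCOSETS_def)
    then obtain k h where kh: "k \<in> K" "h \<in> H" "x = k \<otimes>\<^bsub>G\<^esub> h"
      using cover by blast
    then have "k \<in> carrier G"
      using K top by (auto dest: compactin_subset_topspace)
    moreover have "x \<in> ?q k"
      using kh by (auto simp: l_coset_def)
    ultimately have "?q k = ?q x"
      using l_repr_independence[OF _ _ assms(2)] by blast
    then show "A \<in> ?q ` K" using x kh by blast
  qed
  moreover have "?q ` K \<subseteq> lcosets\<^bsub>G\<^esub> H"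
    using compactin_subset_topspace[OF K] top by (auto simp: LCOSETS_def)
  ultimately show ?thesis
    by (simp add: compact_space_def topspace subset_antisym)
qed

lemma compact_vec3:
  fixes S :: "'a::topological_space set"
  assumes "compact S"
  shows "compact {v :: 'a ^ 3. \<forall>c. v $ c \<in> S}"
proof -
  let ?g = "\<lambda>x :: 'a \<times> 'a \<times> 'a. (\<chi> c. if c = 1 then fst x else if c = 2 then fst (snd x) else snd (snd x)) :: 'a ^ 3"
  have "continuous_on (S \<times> S \<times> S) (\<lambda>x. if c = 1 then fst x else if c = 2 then fst (snd x) else snd (snd x))"
    for c :: 3
    by (cases "c = 1"; cases "c = 2") (auto intro!: continuous_intros)
  then have "continuous_on (S \<times> S \<times> S) ?g"
    by (intro continuous_on_vec_lambda)
  then have "compact (?g ` (S \<times> S \<times> S))"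
    by (intro compact_continuous_image compact_Times assms)
  moreover have "v \<in> ?g ` (S \<times> S \<times> S)" if "\<forall>c. v $ c \<in> S" for v
    using that by (intro image_eqI[of _ _ "(v $ 1, v $ 2, v $ 3)"])
      (auto simp: vec_eq_iff forall_3)
  then have "?g ` (S \<times> S \<times> S) = {v. \<forall>c. v $ c \<in> S}"
    by auto
  ultimately show ?thesis by simp
qed

text \<open>The compact set consists of integral translations and unit diagonals. Lattice diagonals
  first correct the valuations, then lattice translations remove the principal parts.\<close>

lemma lattice_cocompact:
  "compact_space (coset_space SOL_topology SOL (Lambda_lattice :: (('p::prime_card mod_ring fls ^ 3) \<times> _) set))"
proof (rule compact_coset_space[OF group_SOL subgroup_lattice])
  let ?V = "{v :: 'p mod_ring fls ^ 3. \<forall>c. v $ c \<in> {f. fls_subdegree f \<ge> 0}}"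
  let ?D = "{d :: 'p mod_ring fls ^ 3. \<forall>c. d $ c \<in> {f. f \<noteq> 0 \<and> fls_subdegree f = 0}}"
  let ?K = "(\<lambda>x. affine_diag (fst x) (snd x)) ` (?V \<times> ?D)"
  show "topspace SOL_topology = carrier (SOL :: (('p mod_ring fls ^ 3) \<times> _) monoid)"
    by (simp add: SOL_topology_def)
  have "continuous_on (?V \<times> ?D) (\<lambda>x. if i = j then snd x $ i else 0)" for i j :: 3
    by (cases "i = j") (auto intro!: continuous_intros)
  then have "continuous_on (?V \<times> ?D) (\<lambda>x. affine_diag (fst x) (snd x))"
    unfolding affine_diag_def diag_mat_def
    by (intro continuous_on_Pair continuous_on_vec_lambda continuous_on_fst continuous_on_id) auto
  then have "compact ?K"
    by (intro compact_continuous_image compact_Times compact_vec3 compact_fls_integers compact_fls_units)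
  then show "compactin SOL_topology ?K"
    by (auto simp: SOL_topology_def compactin_subtopology norm_one_def)
  fix x :: "('p mod_ring fls ^ 3) \<times> ('p mod_ring fls ^ 3 ^ 3)"
  assume "x \<in> carrier SOL"
  then obtain v d where x: "x = affine_diag v d" and d: "norm_one d"
    by (rule SOL_carrierE)
  \<comment> \<open>The valuations at the first two places determine the lattice diagonal
    \<open>e\<close>; the third then matches because both diagonals have total valuation
    zero.\<close>
  define n m where "n = fls_subdegree (d $ 1)" and "m = fls_subdegree (d $ 2)"
  define e :: "'p mod_ring fls ^ 3" where "e = (\<chi> c. place_t1 $ c powi m * place_t $ c powi n)"
  define u where "u = (\<chi> c. d $ c / e $ c)"
  have e: "e $ c \<noteq> 0" for c
    by (simp add: e_def power_int_eq_0_iff)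
  have "fls_subdegree (e $ c) = fls_subdegree (d $ c)" for c
    using exhaust_3[of c] d
    by (auto simp: e_def subdegree_place_t subdegree_place_t1 n_def m_def norm_one_def sum_3 power_int_eq_0_iff)
  then have u: "u $ c \<noteq> 0 \<and> fls_subdegree (u $ c) = 0" for c
    using d e by (simp add: u_def norm_one_def divide_inverse)
  \<comment> \<open>The approximation is applied to \<open>v / u\<close> because a lattice
    translation \<open>w\<close> enters the product as \<open>u * w\<close>; multiplying by the unit
    \<open>u\<close> keeps the error integral.\<close>
  obtain f g h where approx: "\<And>c. fls_subdegree (v $ c / u $ c - (peval f (inverse (place_t $ c)) +
      peval g (inverse (place_t1 $ c)) + peval h (place_t $ c))) \<ge> 0"
    using places_approximation[of "\<chi> c. v $ c / u $ c"] by auto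
  define w where "w = (\<chi> c. peval f (inverse (place_t $ c)) + peval g (inverse (place_t1 $ c)) +
    peval h (place_t $ c))"
  have "fls_subdegree ((v - u * w) $ c) \<ge> 0" for c
  proof -
    have "(v - u * w) $ c = u $ c * (v $ c / u $ c - w $ c)"
      using u[of c] by (simp add: right_diff_distrib)
    then show ?thesis
      using fls_integral_mult[of "u $ c" "v $ c / u $ c - w $ c"] u[of c] approx[of c] by (simp add: w_def)
  qed
  then have "affine_diag (v - u * w) u \<in> ?K"
    using u by (intro image_eqI[of _ _ "(v - u * w, u)"]) auto
  moreover have "affine_diag w e \<in> Lambda_lattice"
  proof -
    \<comment> \<open>Negative exponents, as the generators carry the inverses of
      \<open>place_t1\<close> and \<open>place_t\<close>.\<close>
    have "lattice_s [^]\<^bsub>SOL\<^esub> (- m) \<otimes>\<^bsub>SOL\<^esub> lattice_t [^]\<^bsub>SOL\<^esub> (- n) \<in>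
        (Lambda_lattice :: (('p mod_ring fls ^ 3) \<times> _) set)"
      by (intro subgroup.m_closed[OF subgroup_lattice]
          group.subgroup_int_pow_closed[OF group_SOL subgroup_lattice] lattice_gens)
    also have "lattice_s [^]\<^bsub>SOL\<^esub> (- m) \<otimes>\<^bsub>SOL\<^esub> lattice_t [^]\<^bsub>SOL\<^esub> (- n) = affine_diag 0 e"
      by (simp add: lattice_gens_def SOL_diagonal_int_pow)
        (simp add: e_def vec_eq_iff power_int_minus power_int_inverse)
    finally have "affine_diag 0 e \<in> Lambda_lattice" .
    from subgroup.m_closed[OF subgroup_lattice lattice_translations[of f g h] this]
    show ?thesis by (simp add: w_def)
  qed
  moreover have "x = affine_diag (v - u * w) u \<otimes>\<^bsub>SOL\<^esub> affine_diag w e"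
    using e by (simp add: x) (simp add: vec_eq_iff u_def)
  ultimately show "\<exists>k\<in>?K. \<exists>h\<in>Lambda_lattice. x = k \<otimes>\<^bsub>SOL\<^esub> h"
    by blast
qed

theorem proposition3p4:
  fixes p :: nat
  assumes "CARD('p::prime_card) = p"
  shows "\<exists>\<Gamma> :: (('p mod_ring fls ^ 3) \<times> ('p mod_ring fls ^ 3 ^ 3)) set.
           cocompact_lattice SOL5_topology SOL5 \<Gamma> \<and> Lambda p \<cong> SOL5\<lparr>carrier := \<Gamma>\<rparr>"
  using Lambda_iso_lattice[where 'p = 'p] subgroup_lattice discrete_lattice lattice_cocompact assms
  unfolding cocompact_lattice_def by blast

end
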